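(* Let $n\ge1$, $p>0$, $f(x)=\exp(|x|^p)$ for $x\in\mathbb{R}^n$, and $$P_f=\{(x,y)\in\mathbb{R}^{n+1}: x\in\mathbb{R}^n,\ y>f(x)\}.$$ Let $\nu=(n-2)/2$ and let $j_\nu$ be the smallest positive zero of the Bessel function $J_\nu$. Then for every $z\in P_f$, the first exit time $\tau_{P_f}(Z)$ of iterated Brownian motion started at $z$ satisfies $$\limsup_{t\to\infty}t^{-1/3}(\log t)^{4/(3p)}\log P_z[\tau_{P_f}(Z)>t]\le-C(p),$$ where $$C(p)=\Big(\frac32\Big)^{(4+3p)/(3p)}2^{1/3}\big(j_\nu^2\,2^{2/p}\big)^{2/3}\Big(\frac{\pi^2}{8}\Big)^{1/3}.$$
   Context: Iterated Brownian motion (IBM) in $\mathbb{R}^m$ started at $z$ (here $m=n+1$): let $X^+,X^-$ be standard $m$-dimensional Brownian motions (generator $\frac12\Delta$) and $Y$ a standard one-dimensional Brownian motion, all three independent and started at $0$. Put $X_t=X^+_t$ for $t\ge 0$ and $X_t=X^-_{-t}$ for $t<0$, and $Z_t=z+X(Y_t)$, $t\ge 0$. For an open set $D$, $\tau_D(Z)=\inf\{t\ge0:Z_t\notin D\}$, and $P_z$ denotes probability for the process started at $z$. *)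

theory Defs
  imports "HOL-Probability.Probability"
begin

section \<open>Brownian motion\<close>

text \<open>Density of the centred Gaussian law on a Euclidean space with covariance \<open>t\<close> times the
  identity, i.e. the transition density of the process with generator half the Laplacian.\<close>

definition gauss_density :: "real \<Rightarrow> 'a::euclidean_space \<Rightarrow> real" where
  "gauss_density t x = (2 * pi * t) powr (- real DIM('a) / 2) * exp (- (norm x)\<^sup>2 / (2 * t))"

text \<open>Only the values of \<open>X\<close> at times \<open>t \<ge> 0\<close> matter. All paths, not merely almost all, start
  at \<open>0\<close> and are continuous; hence exit events of open sets are measurable without completing
  \<open>M\<close>.\<close>

definition brownian_motion :: "'w measure \<Rightarrow> (real \<Rightarrow> 'w \<Rightarrow> 'a::euclidean_space) \<Rightarrow> bool" where
  "brownian_motion M X \<longleftrightarrow>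
     prob_space M \<and>
     (\<forall>t\<ge>0. X t \<in> borel_measurable M) \<and>
     (\<forall>\<omega>\<in>space M. X 0 \<omega> = 0) \<and>
     (\<forall>\<omega>\<in>space M. continuous_on {0..} (\<lambda>t. X t \<omega>)) \<and>
     (\<forall>s t. 0 \<le> s \<longrightarrow> s < t \<longrightarrow>
        distributed M lborel (\<lambda>\<omega>. X t \<omega> - X s \<omega>) (\<lambda>x. ennreal (gauss_density (t - s) x))) \<and>
     (\<forall>(ts :: nat \<Rightarrow> real) k. 0 \<le> ts 0 \<longrightarrow> (\<forall>i<k. ts i < ts (Suc i)) \<longrightarrow>
        prob_space.indep_vars M (\<lambda>_. borel) (\<lambda>i \<omega>. X (ts (Suc i)) \<omega> - X (ts i) \<omega>) {..<k})"

text \<open>The \<open>\<sigma>\<close>-algebra generated by a process indexed by \<open>t \<ge> 0\<close>. Independence of processes is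
  expressed through it because their state spaces may be of different types.\<close>

definition process_events :: "'w measure \<Rightarrow> (real \<Rightarrow> 'w \<Rightarrow> 'a::topological_space) \<Rightarrow> 'w set set" where
  "process_events M X =
     sigma_sets (space M) {X t -` A \<inter> space M | t A. 0 \<le> t \<and> A \<in> sets borel}"

definition indep_processes3 ::
  "'w measure \<Rightarrow> (real \<Rightarrow> 'w \<Rightarrow> 'a::topological_space) \<Rightarrow> (real \<Rightarrow> 'w \<Rightarrow> 'b::topological_space) \<Rightarrow>
     (real \<Rightarrow> 'w \<Rightarrow> 'c::topological_space) \<Rightarrow> bool" where
  "indep_processes3 M X1 X2 X3 \<longleftrightarrow>
     prob_space.indep_sets M
       (\<lambda>i::nat. [process_events M X1, process_events M X2, process_events M X3] ! i) {..<3}"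

section \<open>Iterated Brownian motion\<close>

definition two_sided :: "(real \<Rightarrow> 'w \<Rightarrow> 'a) \<Rightarrow> (real \<Rightarrow> 'w \<Rightarrow> 'a) \<Rightarrow> real \<Rightarrow> 'w \<Rightarrow> 'a" where
  "two_sided Xp Xm t \<omega> = (if t \<ge> 0 then Xp t \<omega> else Xm (- t) \<omega>)"

definition iterated_process ::
  "'a \<Rightarrow> (real \<Rightarrow> 'w \<Rightarrow> 'a) \<Rightarrow> (real \<Rightarrow> 'w \<Rightarrow> 'a) \<Rightarrow> (real \<Rightarrow> 'w \<Rightarrow> real) \<Rightarrow> real \<Rightarrow> 'w \<Rightarrow> 'a::real_vector" where
  "iterated_process z Xp Xm Y t \<omega> = z + two_sided Xp Xm (Y t \<omega>) \<omega>"

text \<open>The infimum is \<open>\<infinity>\<close> for a path that never leaves \<open>D\<close>.\<close>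

definition exit_time :: "'a set \<Rightarrow> (real \<Rightarrow> 'w \<Rightarrow> 'a) \<Rightarrow> 'w \<Rightarrow> ereal" where
  "exit_time D Z \<omega> = Inf {ereal t | t. 0 \<le> t \<and> Z t \<omega> \<notin> D}"

section \<open>Bessel functions of the first kind and their zeros\<close>

text \<open>Power series of \<open>J\<^sub>\<nu>(x)\<close>, used for \<open>x > 0\<close>.\<close>

definition bessel_J :: "real \<Rightarrow> real \<Rightarrow> real" where
  "bessel_J \<nu> x = (\<Sum>k. (- 1) ^ k / fact k * rGamma (\<nu> + real k + 1) * (x / 2) powr (2 * real k + \<nu>))"

definition bessel_zero :: "real \<Rightarrow> real" where
  "bessel_zero \<nu> = (LEAST x. 0 < x \<and> bessel_J \<nu> x = 0)"

section \<open>The domain, the constant and the logarithm\<close>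

text \<open>\<open>\<real>\<^sup>n\<^sup>+\<^sup>1\<close> is represented as the product of \<open>\<real>\<^sup>n\<close> and \<open>\<real>\<close>, which carries the Euclidean norm.\<close>

definition above_graph :: "('a \<Rightarrow> real) \<Rightarrow> ('a \<times> real) set" where
  "above_graph f = {(x, y). f x < y}"

definition C_const :: "nat \<Rightarrow> real \<Rightarrow> real" where
  "C_const n p =
     (3 / 2) powr ((4 + 3 * p) / (3 * p)) * 2 powr (1 / 3) *
     ((bessel_zero ((real n - 2) / 2))\<^sup>2 * 2 powr (2 / p)) powr (2 / 3) * (pi\<^sup>2 / 8) powr (1 / 3)"

text \<open>Logarithm on \<open>[0, \<infinity>)\<close> with value \<open>-\<infinity>\<close> at \<open>0\<close>, in place of the convention \<open>ln 0 = 0\<close>.\<close>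

definition eln :: "real \<Rightarrow> ereal" where
  "eln x = (if x \<le> 0 then - \<infinity> else ereal (ln x))"

end

theory Submission
  imports Defs "HOL-Real_Asymp.Real_Asymp"
begin

text \<open>Let \<open>[-a, b]\<close> be the range of \<open>Y\<close> on \<open>[0, t]\<close>. Then \<open>Z\<close> stays in \<open>P\<^sub>f\<close> up to time \<open>t\<close> iff \<open>z + X\<^sup>+\<close> does
  up to time \<open>b\<close> and \<open>z + X\<^sup>-\<close> up to time \<open>a\<close>. Up to an event of negligible probability, a Brownian
  path of duration \<open>s\<close> stays below height \<open>2 s\<close>, so that survival up to time \<open>s\<close> confines its horizontal part to a ball
  of radius \<open>(ln s) powr (1/p)\<close>; this costs \<open>exp (- j\<^sup>2 s / (2 (ln s) powr (2/p)))\<close>. A range of length \<open>l\<close>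
  costs \<open>exp (- \<pi>\<^sup>2 t / (2 l\<^sup>2))\<close>. Here \<open>l = a + b\<close> is of order \<open>t powr (1/3)\<close> up to logarithms, hence
  \<open>ln s\<close> is about \<open>ln t / 3\<close>, and minimising the total cost over \<open>l\<close> gives \<open>C(p)\<close>.

  Confinement to a ball is estimated on a discrete time grid: the first Dirichlet eigenfunction, cut
  off outside a slightly smaller ball, is almost an eigenfunction of the Gaussian step, because the step is short
  compared with the radius. Hence neither stopping times nor measurability of the exit time are needed.\<close>

section \<open>The radial eigenfunction\<close>

text \<open>Height and confinement can be treated separately because their costs differ in order:
  exceeding height \<open>2 s\<close> costs \<open>3 s / 2\<close> in the exponent at each grid
  time, confinement only \<open>s\<close> divided by a power of \<open>ln s\<close>. A crude
  exponential bound for the height is therefore enough. A cut-off eigenfunction jumps at the edge of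
  the ball. Only upper bounds on its Gaussian average are needed, and removing positive values
  preserves them. The cut is made strictly inside the first zero, so that the function is bounded
  below on the ball and its decay controls a probability. The two durations \<open>a\<close> and
  \<open>b\<close> are functionals of \<open>Y\<close>, and survival involves uncountably many
  times. To use independence, the range is discretised and every survival event is replaced by a
  larger event in the \<sigma>-algebra of a single process. All errors (step length, prefactors, the
  ratio of logarithms, the mesh of the range) are paid for by lowering a rate strictly; the sharp
  constant returns only when the loss is sent to 0 at the very end.\<close>

definition bessel_coeff :: "real \<Rightarrow> nat \<Rightarrow> real" where
  "bessel_coeff d k = (- 1) ^ k / (4 ^ k * fact k) * rGamma (d + real k)"

text \<open>\<open>bessel_Phi d (r\<^sup>2)\<close> is \<open>(r / 2) powr (1 - d)\<close> times the
  Bessel function of order \<open>d - 1\<close> at \<open>r\<close>. For \<open>d = n / 2\<close>,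
  evaluated at the squared norm in n dimensions, it is the radial solution of Delta u = - u that is
  regular at 0. With the squared radius as variable it is a plain power series, so the centre of the
  ball is no special point.\<close>

definition bessel_Phi :: "real \<Rightarrow> real \<Rightarrow> real" where
  "bessel_Phi d s = (\<Sum>k. bessel_coeff d k * s ^ k)"

lemma bessel_coeff_diff:
  "(real k + 1) * bessel_coeff d (Suc k) = - bessel_coeff (d + 1) k / 4"
proof -
  have "(real k + 1) * ((- 1) ^ Suc k / (4 ^ Suc k * ((real k + 1) * fact k)) * r)
      = - ((- 1) ^ k / (4 ^ k * fact k) * r) / 4" for r :: real
    by (simp add: divide_simps add_eq_0_iff)
  then show ?thesis unfolding bessel_coeff_def
    by (simp only: fact_Suc of_nat_mult of_nat_fact of_nat_Suc add.assoc add.commute[of 1])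
qed

lemma bessel_coeff_shift: "(d + real k) * bessel_coeff (d + 1) k = bessel_coeff d k"
proof -
  have "(d + real k) * bessel_coeff (d + 1) k =
      (- 1) ^ k / (4 ^ k * fact k) * ((d + real k) * rGamma (d + real k + 1))"
    by (simp add: bessel_coeff_def ac_simps)
  then show ?thesis unfolding rGamma_plus1 by (simp add: bessel_coeff_def)
qed

lemma bessel_coeff_Suc:
  "4 * (real k + 1) * (d + real k) * bessel_coeff d (Suc k) = - bessel_coeff d k"
proof -
  have "4 * (real k + 1) * (d + real k) * bessel_coeff d (Suc k)
     = 4 * (d + real k) * ((real k + 1) * bessel_coeff d (Suc k))" by (simp only: mult.assoc mult.left_commute[of _ "d + real k"])
  also have "\<dots> = - ((d + real k) * bessel_coeff (d + 1) k)" unfolding bessel_coeff_diff by simp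
  finally show ?thesis unfolding bessel_coeff_shift .
qed

lemma summable_bessel:
  assumes "d > 0"
  shows "summable (\<lambda>k. bessel_coeff d k * s ^ k)"
proof (rule summable_ratio_test[where c="1/2" and N="Suc (nat \<lceil>\<bar>s\<bar>\<rceil>)"])
  fix k assume "k \<ge> Suc (nat \<lceil>\<bar>s\<bar>\<rceil>)"
  then have k: "real k \<ge> 1" "real k \<ge> \<bar>s\<bar>" by linarith+
  have pos: "4 * (real k + 1) * (d + real k) > 0" using assms by simp
  have "bessel_coeff d (Suc k) = - bessel_coeff d k / (4 * (real k + 1) * (d + real k))"
    using bessel_coeff_Suc[of k d] pos by (simp add: field_simps)
  then have "norm (bessel_coeff d (Suc k) * s ^ Suc k)
      = norm (bessel_coeff d k * s ^ k) * (\<bar>s\<bar> / (4 * (real k + 1) * (d + real k)))"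
    using assms by (simp add: abs_mult power_abs)
  also have "\<bar>s\<bar> / (4 * (real k + 1) * (d + real k)) \<le> 1 / 2"
  proof -
    have "2 * \<bar>s\<bar> \<le> 4 * (real k + 1) * 1" using k by simp
    also have "\<dots> \<le> 4 * (real k + 1) * (d + real k)" using k assms by (intro mult_left_mono) auto
    finally show ?thesis using pos by (simp add: field_simps)
  qed
  finally show "norm (bessel_coeff d (Suc k) * s ^ Suc k) \<le> 1 / 2 * norm (bessel_coeff d k * s ^ k)"
    by (metis mult.commute mult_left_mono norm_ge_zero)
qed simp

text \<open>All derivatives stay in the family \<open>bessel_Phi (d + k)\<close>, so Taylor
  expansions and the eigenvalue equation can be stated within it.\<close>

lemma DERIV_bessel_Phi:
  assumes "d > 0"
  shows "(bessel_Phi d has_real_derivative - bessel_Phi (d + 1) s / 4) (at s)"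
proof -
  have "((\<lambda>x. \<Sum>k. bessel_coeff d k * x ^ k) has_real_derivative
      (\<Sum>k. diffs (bessel_coeff d) k * s ^ k)) (at s)"
    by (rule termdiffs_strong_converges_everywhere) (use summable_bessel[OF assms] in auto)
  moreover have "diffs (bessel_coeff d) k * s ^ k = - (1/4) * (bessel_coeff (d + 1) k * s ^ k)" for k
  proof -
    have "diffs (bessel_coeff d) k = (real k + 1) * bessel_coeff d (Suc k)" by (simp add: diffs_def)
    then show ?thesis unfolding bessel_coeff_diff by simp
  qed
  then have "(\<Sum>k. diffs (bessel_coeff d) k * s ^ k) = - (1/4) * bessel_Phi (d + 1) s"
    unfolding bessel_Phi_def using assms by (subst suminf_mult[symmetric]) (auto intro!: summable_bessel)
  ultimately show ?thesis by (simp add: bessel_Phi_def[abs_def])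
qed

lemma DERIV_bessel_Phi_chain:
  assumes "d > 0" "(g has_real_derivative g') (at x within S)"
  shows "((\<lambda>x. bessel_Phi d (g x)) has_real_derivative - bessel_Phi (d + 1) (g x) / 4 * g') (at x within S)"
  using DERIV_chain2[OF DERIV_bessel_Phi[OF assms(1)] assms(2)] by simp

text \<open>By \<open>DERIV_bessel_Phi\<close> the first two terms are the Laplacian of
  \<open>bessel_Phi d\<close> of the squared norm in dimension \<open>2 * d\<close>, so this is
  Delta u = - u. Coefficientwise it splits the factor \<open>d + k\<close> of
  \<open>bessel_coeff_shift\<close>: the \<open>k\<close> part is a derivative, the \<open>d\<close>
  part a multiple.\<close>

lemma bessel_Phi_recurrence:
  assumes "d > 0"
  shows "s / 4 * bessel_Phi (d + 2) s - d * bessel_Phi (d + 1) s + bessel_Phi d s = 0"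
proof -
  have sm: "summable (\<lambda>k. bessel_coeff (d + 1) k * s ^ k)" "summable (\<lambda>k. bessel_coeff (d + 2) k * s ^ k)"
    "summable (\<lambda>k. bessel_coeff d k * s ^ k)"
    using assms by (auto intro!: summable_bessel)
  define a where "a k = real k * bessel_coeff (d + 1) k * s ^ k" for k
  have aS: "a (Suc k) = - (s / 4) * (bessel_coeff (d + 2) k * s ^ k)" for k
    unfolding a_def using bessel_coeff_diff[of k "d + 1"] by (simp add: algebra_simps)
  have "(\<lambda>k. a (Suc k)) sums (- (s / 4) * bessel_Phi (d + 2) s)"
    unfolding aS bessel_Phi_def using sm by (intro sums_mult summable_sums)
  \<comment> \<open>Restoring the first term changes nothing because \<open>a 0 = 0\<close>.\<close>
  then have "a sums (- (s / 4) * bessel_Phi (d + 2) s)"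
    by (subst (asm) sums_Suc_iff) (simp add: a_def)
  moreover have "(\<lambda>k. d * (bessel_coeff (d + 1) k * s ^ k)) sums (d * bessel_Phi (d + 1) s)"
    unfolding bessel_Phi_def using sm by (intro sums_mult summable_sums)
  ultimately have "(\<lambda>k. a k + d * (bessel_coeff (d + 1) k * s ^ k)) sums
     (- (s / 4) * bessel_Phi (d + 2) s + d * bessel_Phi (d + 1) s)" by (rule sums_add)
  moreover have "a k + d * (bessel_coeff (d + 1) k * s ^ k) = bessel_coeff d k * s ^ k" for k
    unfolding a_def bessel_coeff_shift[of d k, symmetric] by (simp add: algebra_simps)
  ultimately have "bessel_Phi d s = - (s / 4) * bessel_Phi (d + 2) s + d * bessel_Phi (d + 1) s"
    unfolding bessel_Phi_def by (simp add: sums_unique[symmetric])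
  then show ?thesis by simp
qed

section \<open>Positive zeros of the Bessel function\<close>

lemma bessel_J_eq:
  assumes "x > 0" and that: "d > 0"
  shows "bessel_J (d - 1) x = (x / 2) powr (d - 1) * bessel_Phi d (x\<^sup>2)"
proof -
  have "(- 1) ^ k / fact k * rGamma (d - 1 + real k + 1) * (x / 2) powr (2 * real k + (d - 1))
     = (x / 2) powr (d - 1) * (bessel_coeff d k * (x\<^sup>2) ^ k)" for k
  proof -
    have "(x / 2) powr (2 * real k + (d - 1)) = (x / 2) powr (d - 1) * ((x / 2)\<^sup>2) ^ k"
    proof -
      have "(x / 2) powr (2 * real k) = (x / 2) powr real (2 * k)" by simp
      also have "\<dots> = ((x / 2)\<^sup>2) ^ k" using assms by (subst powr_realpow) (auto simp: power_mult)
      finally show ?thesis by (simp only: powr_add mult.commute)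
    qed
    also have "((x / 2)\<^sup>2) ^ k = (x\<^sup>2) ^ k / 4 ^ k" by (simp add: power_divide)
    finally show ?thesis by (simp add: bessel_coeff_def ac_simps)
  qed
  then show ?thesis unfolding bessel_J_def bessel_Phi_def
    using summable_bessel[OF that] by (simp add: suminf_mult)
qed

lemma bessel_Phi_0: "bessel_Phi d 0 = rGamma d"
  unfolding bessel_Phi_def using powser_zero[of "bessel_coeff d"] by (simp add: bessel_coeff_def)

lemma continuous_bessel_Phi: "d > 0 \<Longrightarrow> continuous_on S (bessel_Phi d)"
  by (meson DERIV_bessel_Phi DERIV_isCont continuous_at_imp_continuous_on)

lemma bessel_Phi_0_pos: "d > 0 \<Longrightarrow> bessel_Phi d 0 > 0"
  by (simp add: bessel_Phi_0 rGamma_inverse_Gamma Gamma_real_pos)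

text \<open>Sturm comparison: \<open>v r = r powr (d - 1/2) * \<Phi> (r\<^sup>2)\<close> solves \<open>v'' = -(1 - \<alpha> (\<alpha> - 1) / r\<^sup>2) v\<close>
  with \<open>\<alpha> = d - 1/2\<close>, and for large \<open>r\<close> oscillates at least as fast as \<open>sin (r / 2)\<close>.\<close>

lemma bessel_Phi_has_zero:
  assumes d: "d > 0"
  shows "\<exists>x>0. bessel_Phi d (x\<^sup>2) = 0"
proof (rule ccontr)
  assume no: "\<not> ?thesis"
  have pos: "bessel_Phi d (x\<^sup>2) > 0" if "x > 0" for x
  proof (rule ccontr)
    assume "\<not> ?thesis"
    then have "bessel_Phi d (x\<^sup>2) < 0" using no that by force
    moreover have "continuous_on {0..x} (\<lambda>x. bessel_Phi d (x\<^sup>2))"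
      using d by (intro continuous_on_compose2[OF continuous_bessel_Phi[of d UNIV]] continuous_intros) auto
    ultimately have "\<exists>y\<ge>0. y \<le> x \<and> bessel_Phi d (y\<^sup>2) = 0"
      using that bessel_Phi_0_pos[OF d] by (intro IVT2') auto
    then obtain y where "0 \<le> y" "y \<le> x" "bessel_Phi d (y\<^sup>2) = 0" by blast
    moreover have "y \<noteq> 0" using calculation bessel_Phi_0_pos[OF d] by auto
    ultimately show False using no by force
  qed
  define \<alpha> where "\<alpha> = d - 1/2"
  \<comment> \<open>Large enough that the potential term is at most 1/4 beyond \<open>A\<close>,
    where the equation then oscillates faster than u'' = - u / 4.\<close>
  define A where "A = 2 * (\<bar>\<alpha> * (\<alpha> - 1)\<bar> + 1)"
  have A: "A > 0" using abs_ge_zero[of "\<alpha> * (\<alpha> - 1)"] unfolding A_def by argo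
  define v where "v r = r powr \<alpha> * bessel_Phi d (r\<^sup>2)" for r
  define v1 where "v1 r = r powr (\<alpha> - 1) * (\<alpha> * bessel_Phi d (r\<^sup>2) - r\<^sup>2 / 2 * bessel_Phi (d + 1) (r\<^sup>2))" for r
  define v2 where "v2 r = (\<alpha> * (\<alpha> - 1) / r\<^sup>2 - 1) * v r" for r
  have v: "(v has_real_derivative v1 r) (at r)" if "r > 0" for r
  proof -
    have "r powr \<alpha> = r powr (\<alpha> - 1) * r" using that by (simp add: powr_diff)
    then show ?thesis unfolding v_def v1_def using that d
      by (auto intro!: derivative_eq_intros DERIV_bessel_Phi_chain simp: field_simps power2_eq_square)
  qed
  have v1: "(v1 has_real_derivative v2 r) (at r)" if r: "r > 0" for r
  proof -
    have e1: "r powr (\<alpha> - 1) = r powr (\<alpha> - 1 - 1) * r"  "r powr \<alpha> = r powr (\<alpha> - 1 - 1) * r\<^sup>2"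
      using r by (simp_all add: powr_diff power2_eq_square)
    have rec: "bessel_Phi d (r\<^sup>2) = d * bessel_Phi (d + 1) (r\<^sup>2) - r\<^sup>2 / 4 * bessel_Phi (d + 2) (r\<^sup>2)"
      using bessel_Phi_recurrence[OF d, of "r\<^sup>2"] by simp
    let ?D = "(\<alpha> - 1) * r powr (\<alpha> - 1 - 1) * (\<alpha> * bessel_Phi d (r\<^sup>2) - r\<^sup>2 / 2 * bessel_Phi (d + 1) (r\<^sup>2))
        + r powr (\<alpha> - 1) * (\<alpha> * (- bessel_Phi (d + 1) (r\<^sup>2) / 4 * (2 * r))
           - (r * bessel_Phi (d + 1) (r\<^sup>2) + r\<^sup>2 / 2 * (- bessel_Phi (d + 1 + 1) (r\<^sup>2) / 4 * (2 * r))))"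
    have "(v1 has_real_derivative ?D) (at r)"
      unfolding v1_def using r d
      by (auto intro!: derivative_eq_intros DERIV_bessel_Phi_chain simp: field_simps)
    moreover have "?D = v2 r"
    proof -
      have "v2 r = r powr (\<alpha> - 1 - 1) * (\<alpha> * (\<alpha> - 1) - r\<^sup>2) * bessel_Phi d (r\<^sup>2)"
        unfolding v2_def v_def e1 using r by (simp add: field_simps)
      also have "\<dots> = r powr (\<alpha> - 1 - 1) * (\<alpha> * (\<alpha> - 1) * bessel_Phi d (r\<^sup>2) - r\<^sup>2 *
         (d * bessel_Phi (d + 1) (r\<^sup>2) - r\<^sup>2 / 4 * bessel_Phi (d + 2) (r\<^sup>2)))"
        unfolding rec[symmetric] by (simp add: algebra_simps)
      finally have v2: "v2 r = \<dots>" .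
      \<comment> \<open>\<open>P\<close> stands for \<open>r powr (\<alpha> - 1 - 1)\<close>. The
        coefficients of \<open>f1\<close> add up to \<open>\<alpha> + 1 / 2 = d\<close>, which is
        where the choice of \<alpha> enters.\<close>
      have "(\<alpha> - 1) * P * (\<alpha> * f0 - r\<^sup>2 / 2 * f1)
        + P * r * (\<alpha> * (- f1 / 4 * (2 * r)) - (r * f1 + r\<^sup>2 / 2 * (- f2 / 4 * (2 * r))))
        = P * (\<alpha> * (\<alpha> - 1) * f0 - r\<^sup>2 * (d * f1 - r\<^sup>2 / 4 * f2))" for P f0 f1 f2
        unfolding \<alpha>_def by (simp add: power2_eq_square) algebra
      moreover have "d + 1 + 1 = d + 2" by simp
      ultimately show ?thesis unfolding v2 e1 by presburger
    qed
    ultimately show ?thesis by simp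
  qed
  \<comment> \<open>Wronskian of \<open>v\<close> and sin ((r - A) / 2). On an interval of length 2
    pi the sine is nonnegative and vanishes at both ends, where the cosine is 1 and -1. A positive
    \<open>v\<close> would make \<open>F\<close> nonincreasing with a negative left and a positive
    right end value.\<close>
  define F where "F r = v1 r * sin ((r - A) / 2) - v r * cos ((r - A) / 2) / 2" for r
  have "F (A + 2 * pi) \<le> F A"
  proof (rule DERIV_nonpos_imp_nonincreasing[where f=F])
    fix r assume r: "A \<le> r" "r \<le> A + 2 * pi"
    then have r0: "r > 0" using A by simp
    have "(F has_real_derivative (v2 r + v r / 4) * sin ((r - A) / 2)) (at r)"
      unfolding F_def using r0
      by (auto intro!: derivative_eq_intros v v1 simp: field_simps)
    moreover have "v2 r + v r / 4 \<le> 0"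
    proof -
      have "4 * \<bar>\<alpha> * (\<alpha> - 1)\<bar> \<le> A\<^sup>2"
      proof -
        have "4 * c \<le> (2 * (c + 1))\<^sup>2" if "c \<ge> 0" for c :: real
          using that by (simp add: power2_eq_square algebra_simps)
        then show ?thesis unfolding A_def by simp
      qed
      also have "\<dots> \<le> r\<^sup>2" using r A by (intro power_mono) auto
      finally have "\<alpha> * (\<alpha> - 1) \<le> 1 / 4 * r\<^sup>2" using abs_ge_self[of "\<alpha> * (\<alpha> - 1)"] by argo
      then have "\<alpha> * (\<alpha> - 1) / r\<^sup>2 \<le> 1 / 4" using r0 by (subst pos_divide_le_eq) auto
      moreover have "v r > 0" unfolding v_def using pos[OF r0] r0 by simp
      ultimately have "(\<alpha> * (\<alpha> - 1) / r\<^sup>2 - 1) * v r \<le> (1 / 4 - 1) * v r"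
        by (intro mult_right_mono diff_right_mono) simp_all
      then show ?thesis using \<open>v r > 0\<close> unfolding v2_def by (simp add: algebra_simps)
    qed
    moreover have "sin ((r - A) / 2) \<ge> 0" using r by (intro sin_ge_zero) auto
    ultimately show "\<exists>y. (F has_real_derivative y) (at r) \<and> y \<le> 0"
      by (meson mult_nonpos_nonneg)
  qed simp
  moreover have "F (A + 2 * pi) = v (A + 2 * pi) / 2" "F A = - v A / 2" by (simp_all add: F_def)
  moreover have "v A > 0" "v (A + 2 * pi) > 0" 
  proof -
    have "v r > 0" if "r > 0" for r unfolding v_def using that pos[OF that] by simp
    then show "v A > 0" "v (A + 2 * pi) > 0" using A pi_gt_zero by (simp_all add: add_pos_pos)
  qed
  ultimately show False by simp
qed

text \<open>\<open>LEAST\<close> on the reals is meaningful only if the minimum is attained. It is: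
  the zeros in \<open>{0..x0}\<close> form a nonempty compact set that does not contain 0.
  Positivity before the first zero is the intermediate value theorem.\<close>

lemma bessel_zero_first:
  assumes d: "d > 0"
  shows "bessel_zero (d - 1) > 0" "\<And>s. 0 \<le> s \<Longrightarrow> s < (bessel_zero (d - 1))\<^sup>2 \<Longrightarrow> bessel_Phi d s > 0"
proof -
  obtain x0 where x0: "x0 > 0" "bessel_Phi d (x0\<^sup>2) = 0" using bessel_Phi_has_zero[OF d] by blast
  define Z where "Z = {x\<in>{0..x0}. bessel_Phi d (x\<^sup>2) = 0}"
  have cont: "continuous_on S (\<lambda>x. bessel_Phi d (x\<^sup>2))" for S
    using d by (intro continuous_on_compose2[OF continuous_bessel_Phi[of d UNIV]] continuous_intros) auto
  have "compact Z"
  proof -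
    have "closed ({0..x0} \<inter> (\<lambda>x. bessel_Phi d (x\<^sup>2)) -` {0})"
      using cont by (intro continuous_closed_preimage) auto
    then show ?thesis unfolding Z_def
      by (auto simp: compact_eq_bounded_closed vimage_def Int_def intro: bounded_subset[of "{0..x0}"])
  qed
  moreover have "x0 \<in> Z" using x0 by (auto simp: Z_def)
  ultimately obtain j where j: "j \<in> Z" "\<And>x. x \<in> Z \<Longrightarrow> j \<le> x"
    using compact_attains_inf[of Z] by blast
  have jpos: "j > 0" using j(1) bessel_Phi_0_pos[OF d] by (cases "j = 0") (auto simp: Z_def)
  \<comment> \<open>The factor \<open>(x / 2) powr (d - 1)\<close> does not vanish for
    \<open>x > 0\<close>.\<close>
  have zero_iff: "bessel_J (d - 1) x = 0 \<longleftrightarrow> bessel_Phi d (x\<^sup>2) = 0" if "x > 0" for x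
    using that by (simp add: bessel_J_eq d)
  have "bessel_zero (d - 1) = j"
    unfolding bessel_zero_def
  proof (rule Least_equality)
    show "0 < j \<and> bessel_J (d - 1) j = 0" using jpos j(1) zero_iff by (auto simp: Z_def)
    fix y assume y: "0 < y \<and> bessel_J (d - 1) y = 0"
    show "j \<le> y"
    proof (cases "y \<le> x0")
      case True then show ?thesis using y zero_iff by (intro j(2)) (auto simp: Z_def)
    next
      case False then show ?thesis using j(1) by (auto simp: Z_def)
    qed
  qed
  then show "bessel_zero (d - 1) > 0" using jpos by simp
  fix s assume s: "0 \<le> s" "s < (bessel_zero (d - 1))\<^sup>2"
  show "bessel_Phi d s > 0"
  proof (rule ccontr)
    assume neg: "\<not> ?thesis"
    obtain y where "0 \<le> y" "y \<le> s" "bessel_Phi d y = 0"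
      using IVT2'[of "bessel_Phi d" s 0 0] s bessel_Phi_0_pos[OF d] continuous_bessel_Phi[OF d] neg by auto
    moreover have "sqrt y < j" using calculation s \<open>bessel_zero (d - 1) = j\<close> jpos
      by (intro real_less_lsqrt) auto
    moreover have "j \<le> x0" using j(1) by (auto simp: Z_def)
    ultimately have "sqrt y \<in> Z" by (auto simp: Z_def)
    then show False using j(2) \<open>sqrt y < j\<close> by force
  qed
qed

text \<open>Dimension one: the eigenfunction of a symmetric interval is the cosine. The induction
  \<open>fct\<close> is the duplication formula at half-integers.\<close>

lemma bessel_Phi_half: "bessel_Phi (1 / 2) (x\<^sup>2) = rGamma (1 / 2) * cos x"
proof -
  have fct: "rGamma (1 / 2 + real k) * fact (2 * k) = 4 ^ k * fact k * rGamma (1 / 2)" for k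
  proof (induction k)
    case (Suc k)
    have "fact (2 * Suc k) = (2 * real k + 2) * (2 * real k + 1) * fact (2 * k)"
      by (simp add: algebra_simps)
    then have "rGamma (1 / 2 + real (Suc k)) * fact (2 * Suc k) =
       (4 * real k + 4) * (((1/2 + real k) * rGamma (1/2 + real k + 1)) * fact (2 * k))"
      by (simp add: algebra_simps)
    also have "\<dots> = (4 * real k + 4) * (4 ^ k * fact k * rGamma (1 / 2))"
      unfolding rGamma_plus1 Suc.IH by simp
    finally show ?case by (simp add: algebra_simps)
  qed simp
  have "bessel_coeff (1 / 2) k * (x\<^sup>2) ^ k = rGamma (1 / 2) * ((- 1) ^ k / fact (2 * k) * x ^ (2 * k))" for k
  proof -
    have "rGamma (1 / 2 + real k) = 4 ^ k * fact k * rGamma (1 / 2) / fact (2 * k)"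
      using fct[of k] by (simp add: field_simps)
    then show ?thesis by (simp add: bessel_coeff_def power_mult)
  qed
  then show ?thesis using sums_mult[OF cos_paired, of "rGamma (1 / 2)" x]
    unfolding bessel_Phi_def by (simp add: sums_iff)
qed

text \<open>Feeds the value pi / 2 into the ball estimate for \<open>Y\<close> directly, without
  evaluating \<open>bessel_zero\<close> at order -1/2.\<close>

lemma bessel_Phi_half_pos: "0 \<le> s \<Longrightarrow> s < (pi / 2)\<^sup>2 \<Longrightarrow> bessel_Phi (1 / 2) s > 0"
proof -
  assume s: "0 \<le> s" "s < (pi / 2)\<^sup>2"
  then have "sqrt s < pi / 2" by (intro real_less_lsqrt) auto
  then have "cos (sqrt s) > 0" using s by (intro cos_gt_zero_pi) (auto intro: less_le_trans[of _ 0])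
  moreover have "rGamma (1 / 2 :: real) > 0" by (simp add: rGamma_inverse_Gamma Gamma_real_pos)
  ultimately show ?thesis using bessel_Phi_half[of "sqrt s"] s by simp
qed

section \<open>Gaussian moments\<close>

definition gaussian :: "real \<Rightarrow> 'a::euclidean_space measure" where
  "gaussian t = density lborel (\<lambda>x. ennreal (gauss_density t x))"

lemma sets_gaussian [simp, measurable_cong]: "sets (gaussian t) = sets borel"
  and space_gaussian [simp]: "space (gaussian t) = UNIV"
  by (simp_all add: gaussian_def)

lemma gauss_density_nonneg: "0 \<le> gauss_density t x"
  by (simp add: gauss_density_def)

lemma borel_measurable_gauss_density [measurable]: "gauss_density t \<in> borel_measurable borel"
  unfolding gauss_density_def[abs_def] by measurable

lemma gauss_density_prod:
  fixes x :: "'a::euclidean_space"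
  assumes t: "t > 0"
  shows "gauss_density t x = (\<Prod>b\<in>Basis. normal_density 0 (sqrt t) (x \<bullet> b))"
proof -
  have "(norm x)\<^sup>2 = (\<Sum>b\<in>Basis. (x \<bullet> b)\<^sup>2)"
    unfolding power2_norm_eq_inner by (subst euclidean_inner) (simp add: power2_eq_square)
  then have "exp (- (norm x)\<^sup>2 / (2 * t)) = (\<Prod>b\<in>Basis. exp (- (x \<bullet> b)\<^sup>2 / (2 * t)))"
    by (simp add: exp_sum[symmetric] sum_negf sum_divide_distrib)
  moreover have "(2 * pi * t) powr (- real DIM('a) / 2) = (\<Prod>b\<in>(Basis::'a set). 1 / sqrt (2 * pi * t))"
  proof -
    have "(2 * pi * t) powr (- real DIM('a) / 2) = ((2 * pi * t) powr (- 1 / 2)) powr real DIM('a)"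
      by (simp add: powr_powr)
    also have "\<dots> = ((2 * pi * t) powr (- 1 / 2)) ^ DIM('a)"
      using t by (subst powr_realpow) auto
    also have "(2 * pi * t) powr (- 1 / 2) = 1 / sqrt (2 * pi * t)"
      using t by (simp add: powr_minus_divide powr_half_sqrt)
    finally show ?thesis by simp
  qed
  moreover have "normal_density 0 (sqrt t) y = 1 / sqrt (2 * pi * t) * exp (- y\<^sup>2 / (2 * t))" for y
    using t by (simp add: normal_density_def)
  ultimately show ?thesis unfolding gauss_density_def by (simp only: prod.distrib)
qed

text \<open>The value is \<open>t ^ k\<close> times the double factorial of
  \<open>2 * k - 1\<close>, in the form of \<open>normal_moment_even\<close>. The case
  \<open>k = 0\<close> yields total mass one.\<close>

lemma nn_integral_gaussian_even_moment:
  fixes c :: "'a::euclidean_space"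
  assumes t: "t > 0" and c: "c \<in> Basis"
  shows "(\<integral>\<^sup>+h. ennreal ((h \<bullet> c) ^ (2 * k)) \<partial>gaussian t) = ennreal (fact (2 * k) / ((2 / t) ^ k * fact k))"
proof -
  define f where "f b x = ennreal (normal_density 0 (sqrt t) x * (if b = c then x ^ (2 * k) else 1))" for b :: 'a and x
  have [measurable]: "f b \<in> borel_measurable borel" for b
    unfolding f_def[abs_def] by (cases "b = c") auto
  have "(\<integral>\<^sup>+h. ennreal ((h \<bullet> c) ^ (2 * k)) \<partial>gaussian t)
      = (\<integral>\<^sup>+h. ennreal (gauss_density t h) * ennreal ((h \<bullet> c) ^ (2 * k)) \<partial>lborel)"
    unfolding gaussian_def by (intro nn_integral_density) measurable
  also have "\<dots> = (\<integral>\<^sup>+h. (\<Prod>b\<in>Basis. f b (h \<bullet> b)) \<partial>lborel)"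
  proof (intro nn_integral_cong)
    fix h :: 'a
    have "(\<Prod>b\<in>Basis. (if b = c then (h \<bullet> b) ^ (2 * k) else 1)) = (h \<bullet> c) ^ (2 * k)"
      using c by (subst prod.delta) auto
    then have "gauss_density t h * (h \<bullet> c) ^ (2 * k) =
       (\<Prod>b\<in>Basis. normal_density 0 (sqrt t) (h \<bullet> b) * (if b = c then (h \<bullet> b) ^ (2 * k) else 1))"
      unfolding prod.distrib gauss_density_prod[OF t] by simp
    then show "ennreal (gauss_density t h) * ennreal ((h \<bullet> c) ^ (2 * k)) = (\<Prod>b\<in>Basis. f b (h \<bullet> b))"
      unfolding f_def using normal_density_nonneg[of 0 "sqrt t"]
      by (subst prod_ennreal) (auto simp: ennreal_mult'[symmetric] gauss_density_nonneg)
  qed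
  also have "\<dots> = (\<Prod>b\<in>Basis. (\<integral>\<^sup>+x. f b x \<partial>lborel))"
    by (intro nn_integral_lborel_prod) auto
  also have "\<dots> = (\<Prod>b\<in>Basis. if b = c then ennreal (fact (2 * k) / ((2 / t) ^ k * fact k)) else 1)"
  proof (intro prod.cong refl)
    fix b :: 'a
    have "(\<integral>\<^sup>+x. ennreal (normal_density 0 (sqrt t) x * (x - 0) ^ (2 * j)) \<partial>lborel)
       = ennreal (fact (2 * j) / ((2 / t) ^ j * fact j))" for j
      using normal_moment_even[of "sqrt t" 0 j] t
      by (subst nn_integral_eq_integral) (auto simp: has_bochner_integral_iff)
    \<comment> \<open>The instance 0 evaluates the factors of the other coordinates to 1.\<close>
    from this[of k] this[of 0]
    show "(\<integral>\<^sup>+x. f b x \<partial>lborel) = (if b = c then ennreal (fact (2 * k) / ((2 / t) ^ k * fact k)) else 1)"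
      by (auto simp: f_def)
  qed
  also have "\<dots> = ennreal (fact (2 * k) / ((2 / t) ^ k * fact k))"
    using c by (subst prod.delta) auto
  finally show ?thesis .
qed

lemma prob_space_gaussian: "t > 0 \<Longrightarrow> prob_space (gaussian t :: 'a::euclidean_space measure)"
  using nn_integral_gaussian_even_moment[of t "SOME b. b \<in> Basis" 0]
  by (intro prob_spaceI) (simp add: SOME_Basis)

lemma gaussian_even_moment:
  fixes c :: "'a::euclidean_space"
  assumes "t > 0" "c \<in> Basis"
  shows "integrable (gaussian t) (\<lambda>h. (h \<bullet> c) ^ (2 * k))"
    and "(\<integral>h. (h \<bullet> c) ^ (2 * k) \<partial>gaussian t) = fact (2 * k) / ((2 / t) ^ k * fact k)"
proof -
  show int: "integrable (gaussian t) (\<lambda>h. (h \<bullet> c) ^ (2 * k))"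
    by (intro integrableI_nn_integral_finite[OF _ _ nn_integral_gaussian_even_moment[OF assms]]) auto
  show "(\<integral>h. (h \<bullet> c) ^ (2 * k) \<partial>gaussian t) = fact (2 * k) / ((2 / t) ^ k * fact k)"
    using assms by (subst integral_eq_nn_integral) (auto simp: nn_integral_gaussian_even_moment)
qed

lemma gaussian_second_moment:
  fixes c :: "'a::euclidean_space"
  assumes "t > 0" "c \<in> Basis"
  shows "integrable (gaussian t) (\<lambda>h. (h \<bullet> c)\<^sup>2)" "(\<integral>h. (h \<bullet> c)\<^sup>2 \<partial>gaussian t) = t"
  using gaussian_even_moment[OF assms, of 1] assms by simp_all

section \<open>Symmetries of the Gaussian law and its covariance\<close>

lemma distr_gaussian_eq:
  fixes T :: "'a::euclidean_space \<Rightarrow> 'a"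
  assumes [measurable]: "T \<in> borel_measurable borel"
    and T: "distr lborel borel T = lborel" and n: "\<And>x. norm (T x) = norm x"
  shows "distr (gaussian t) borel T = gaussian t"
proof -
  have "gauss_density t (T x) = gauss_density t x" for x by (simp add: gauss_density_def n)
  then have "distr (gaussian t) borel T = distr (density lborel (\<lambda>x. ennreal (gauss_density t (T x)))) borel T"
    by (simp add: gaussian_def)
  also have "\<dots> = density (distr lborel borel T) (\<lambda>x. ennreal (gauss_density t x))"
    by (rule density_distr[symmetric]) auto
  finally show ?thesis by (simp add: T gaussian_def)
qed

lemma distr_gaussian_reflect:
  fixes c :: "'a::euclidean_space"
  assumes c: "c \<in> Basis"
  shows "distr (gaussian t) borel (\<lambda>x. x - (2 * (x \<bullet> c)) *\<^sub>R c) = gaussian t"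
proof (rule distr_gaussian_eq)
  define s :: "'a \<Rightarrow> real" where "s b = (if b = c then - 1 else 1)" for b
  have T: "x - (2 * (x \<bullet> c)) *\<^sub>R c = 0 + (\<Sum>j\<in>Basis. (s j * (x \<bullet> j)) *\<^sub>R j)" for x
  proof (rule euclidean_eqI)
    fix b :: 'a assume b: "b \<in> Basis"
    show "(x - (2 * (x \<bullet> c)) *\<^sub>R c) \<bullet> b = (0 + (\<Sum>j\<in>Basis. (s j * (x \<bullet> j)) *\<^sub>R j)) \<bullet> b"
      using b c by (auto simp: inner_sum_left inner_Basis s_def inner_diff_left if_distrib cong: if_cong)
  qed
  have "(\<Prod>j\<in>Basis. \<bar>s j\<bar>) = 1" by (intro prod.neutral) (simp add: s_def)
  then have "lborel = density (distr lborel borel (\<lambda>x. x - (2 * (x \<bullet> c)) *\<^sub>R c)) (\<lambda>_. 1)"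
    using lborel_affine_euclidean[of s 0] unfolding T by (simp add: s_def)
  then show "distr lborel borel (\<lambda>x. x - (2 * (x \<bullet> c)) *\<^sub>R c) = lborel" by (simp add: density_1)
  have "c \<bullet> c = 1" using c by simp
  then show "norm (x - (2 * (x \<bullet> c)) *\<^sub>R c) = norm x" for x
    unfolding norm_eq_sqrt_inner by (simp add: inner_diff_left inner_diff_right inner_commute algebra_simps)
qed measurable

lemma distr_gaussian_uminus: "distr (gaussian t) borel uminus = (gaussian t :: 'a::euclidean_space measure)"
proof (rule distr_gaussian_eq)
  show "distr lborel borel uminus = (lborel :: 'a measure)"
    using lborel_affine[of "-1" "0 :: 'a"] by (simp add: density_1)
qed auto

text \<open>Reversing coordinate \<open>c\<close> preserves the law and changes the sign of the
  integrand.\<close>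

lemma gaussian_mixed_moment:
  fixes b c :: "'a::euclidean_space"
  assumes t: "t > 0" and bc: "b \<in> Basis" "c \<in> Basis" "b \<noteq> c"
  shows "integrable (gaussian t) (\<lambda>h. (h \<bullet> b) * (h \<bullet> c))"
    and "(\<integral>h. (h \<bullet> b) * (h \<bullet> c) \<partial>gaussian t) = 0"
proof -
  show "integrable (gaussian t) (\<lambda>h. (h \<bullet> b) * (h \<bullet> c))"
  proof (rule Bochner_Integration.integrable_bound)
    show "integrable (gaussian t) (\<lambda>h. (h \<bullet> b)\<^sup>2 + (h \<bullet> c)\<^sup>2)"
      using gaussian_second_moment(1)[OF t] bc by (intro Bochner_Integration.integrable_add) auto
    have "\<bar>x * y\<bar> \<le> \<bar>x\<^sup>2 + y\<^sup>2\<bar>" for x y :: real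
    proof -
      have "2 * \<bar>x * y\<bar> \<le> x\<^sup>2 + y\<^sup>2"
        using sum_squares_bound[of "\<bar>x\<bar>" "\<bar>y\<bar>"] by (simp add: abs_mult)
      then show ?thesis using abs_ge_zero[of "x * y"] by linarith
    qed
    then show "AE h in gaussian t. norm ((h \<bullet> b) * (h \<bullet> c)) \<le> norm ((h \<bullet> b)\<^sup>2 + (h \<bullet> c)\<^sup>2)" by simp
  qed measurable
  have "(\<integral>h. (h \<bullet> b) * (h \<bullet> c) \<partial>gaussian t)
     = (\<integral>h. (h \<bullet> b) * (h \<bullet> c) \<partial>distr (gaussian t) borel (\<lambda>x. x - (2 * (x \<bullet> c)) *\<^sub>R c))"
    by (simp add: distr_gaussian_reflect[OF bc(2)])
  also have "\<dots> = (\<integral>h. - ((h \<bullet> b) * (h \<bullet> c)) \<partial>gaussian t)"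
  proof (subst integral_distr)
    have "(h - (2 * (h \<bullet> c)) *\<^sub>R c) \<bullet> b = h \<bullet> b" "(h - (2 * (h \<bullet> c)) *\<^sub>R c) \<bullet> c = - (h \<bullet> c)" for h
      using bc by (simp_all add: inner_diff_left inner_Basis)
    then show "(\<integral>h. ((h - (2 * (h \<bullet> c)) *\<^sub>R c) \<bullet> b) * ((h - (2 * (h \<bullet> c)) *\<^sub>R c) \<bullet> c) \<partial>gaussian t)
        = (\<integral>h. - ((h \<bullet> b) * (h \<bullet> c)) \<partial>gaussian t)" by simp
  qed measurable
  finally show "(\<integral>h. (h \<bullet> b) * (h \<bullet> c) \<partial>gaussian t) = 0" by simp
qed

lemma gaussian_quadratic_moment:
  fixes x :: "'a::euclidean_space"
  assumes t: "t > 0" and B: "B \<subseteq> Basis"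
  shows "integrable (gaussian t) (\<lambda>h. (\<Sum>b\<in>B. (x \<bullet> b) * (h \<bullet> b))\<^sup>2)"
    and "(\<integral>h. (\<Sum>b\<in>B. (x \<bullet> b) * (h \<bullet> b))\<^sup>2 \<partial>gaussian t) = t * (\<Sum>b\<in>B. (x \<bullet> b)\<^sup>2)"
proof -
  have fin: "finite B" using B by (rule finite_subset) simp
  have eq: "(\<Sum>b\<in>B. (x \<bullet> b) * (h \<bullet> b))\<^sup>2 =
     (\<Sum>b\<in>B. \<Sum>c\<in>B. ((x \<bullet> b) * (x \<bullet> c)) * ((h \<bullet> b) * (h \<bullet> c)))" for h
    unfolding power2_eq_square sum_product by (simp add: ac_simps)
  have int: "integrable (gaussian t) (\<lambda>h. (h \<bullet> b) * (h \<bullet> c))"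
    and val: "(\<integral>h. (h \<bullet> b) * (h \<bullet> c) \<partial>gaussian t) = (if b = c then t else 0)"
    if "b \<in> B" "c \<in> B" for b c
    using gaussian_mixed_moment[OF t, of b c] gaussian_second_moment[OF t, of b] that B
    by (cases "b = c"; auto simp: power2_eq_square)+
  show "integrable (gaussian t) (\<lambda>h. (\<Sum>b\<in>B. (x \<bullet> b) * (h \<bullet> b))\<^sup>2)"
    unfolding eq by (intro Bochner_Integration.integrable_sum Bochner_Integration.integrable_mult_right int)
  have "(\<integral>h. (\<Sum>b\<in>B. (x \<bullet> b) * (h \<bullet> b))\<^sup>2 \<partial>gaussian t)
     = (\<Sum>b\<in>B. \<Sum>c\<in>B. ((x \<bullet> b) * (x \<bullet> c)) * (if b = c then t else 0))"
    unfolding eq by (simp add: int val Bochner_Integration.integral_sum Bochner_Integration.integrable_sum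
        Bochner_Integration.integrable_mult_right cong: sum.cong)
  also have "\<dots> = (\<Sum>b\<in>B. ((x \<bullet> b) * (x \<bullet> b)) * t)"
    using fin by (intro sum.cong refl) (simp add: if_distrib cong: if_cong)
  finally show "(\<integral>h. (\<Sum>b\<in>B. (x \<bullet> b) * (h \<bullet> b))\<^sup>2 \<partial>gaussian t) = t * (\<Sum>b\<in>B. (x \<bullet> b)\<^sup>2)"
    by (simp add: sum_distrib_left power2_eq_square ac_simps)
qed

text \<open>Chernoff bound with the exponential parameter fixed at 1 instead of optimised: for
  \<open>a = 2 * S\<close> and \<open>t \<le> S\<close> it already gives
  \<open>exp (- (3 * S / 2))\<close>.\<close>

lemma gaussian_upper_tail:
  fixes c :: "'a::euclidean_space"
  assumes t: "t > 0" and c: "c \<in> Basis"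
  shows "measure (gaussian t) {h. h \<bullet> c \<ge> a} \<le> exp (t / 2 - a)"
proof -
  interpret prob_space "gaussian t :: 'a measure" by (rule prob_space_gaussian[OF t])
  have cc: "c \<bullet> c = 1" using c by simp
  \<comment> \<open>Completing the square: the exponential tilt is a translation by
    \<open>t *\<^sub>R c\<close>, so translation invariance of Lebesgue measure gives the moment
    generating function.\<close>
  have shift: "gauss_density t h * exp (h \<bullet> c) = exp (t / 2) * gauss_density t ((- t *\<^sub>R c) + h)" for h
  proof -
    have "(norm ((- t *\<^sub>R c) + h))\<^sup>2 = (norm h)\<^sup>2 - 2 * t * (h \<bullet> c) + t\<^sup>2"
      unfolding power2_norm_eq_inner using cc
      by (simp add: inner_add_left inner_add_right inner_diff_left inner_diff_right inner_commute power2_eq_square algebra_simps)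
    then have "- (norm h)\<^sup>2 / (2 * t) + h \<bullet> c = t / 2 + - (norm ((- t *\<^sub>R c) + h))\<^sup>2 / (2 * t)"
      using t by (simp add: field_simps power2_eq_square)
    then have "exp (- (norm h)\<^sup>2 / (2 * t)) * exp (h \<bullet> c) = exp (t / 2) * exp (- (norm ((- t *\<^sub>R c) + h))\<^sup>2 / (2 * t))"
      by (simp only: exp_add[symmetric])
    then show ?thesis unfolding gauss_density_def by (simp add: ac_simps)
  qed
  have "(\<integral>\<^sup>+h. ennreal (exp (h \<bullet> c)) \<partial>gaussian t)
      = (\<integral>\<^sup>+h. ennreal (gauss_density t h) * ennreal (exp (h \<bullet> c)) \<partial>lborel)"
    unfolding gaussian_def by (intro nn_integral_density) measurable
  also have "\<dots> = (\<integral>\<^sup>+h. ennreal (exp (t / 2)) * ennreal (gauss_density t ((- t *\<^sub>R c) + h)) \<partial>lborel)"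
    by (simp only: ennreal_mult''[symmetric] shift exp_ge_zero gauss_density_nonneg)
  also have "\<dots> = ennreal (exp (t / 2)) * (\<integral>\<^sup>+h. ennreal (gauss_density t h) \<partial>distr lborel borel ((+) (- t *\<^sub>R c)))"
    by (subst nn_integral_distr) (auto intro!: nn_integral_cmult)
  also have "\<dots> = ennreal (exp (t / 2)) * emeasure (gaussian t) (space (gaussian t :: 'a measure))"
    unfolding lborel_distr_plus by (simp add: gaussian_def emeasure_density)
  finally have mgf: "(\<integral>\<^sup>+h. ennreal (exp (h \<bullet> c)) \<partial>gaussian t) = ennreal (exp (t / 2))"
    by (simp only: emeasure_space_1 mult_1_right)
  have "emeasure (gaussian t) {h. h \<bullet> c \<ge> a} = (\<integral>\<^sup>+h. indicator {h. h \<bullet> c \<ge> a} h \<partial>gaussian t)"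
    by (intro nn_integral_indicator[symmetric]) measurable
  also have "\<dots> \<le> (\<integral>\<^sup>+h. ennreal (exp (- a)) * ennreal (exp (h \<bullet> c)) \<partial>gaussian t)"
    by (intro nn_integral_mono) (auto simp: indicator_def ennreal_mult''[symmetric] exp_add[symmetric])
  also have "\<dots> = ennreal (exp (- a)) * ennreal (exp (t / 2))"
    by (subst nn_integral_cmult) (auto simp: mgf)
  also have "\<dots> = ennreal (exp (t / 2 - a))"
    by (simp add: ennreal_mult''[symmetric] exp_add[symmetric])
  finally show ?thesis by (simp add: emeasure_eq_measure)
qed

section \<open>Random walks with Gaussian steps\<close>

text \<open>A supermartingale estimate: the walk killed outside \<open>D\<close> and weighted by
  \<open>w\<close> loses a factor \<rho> per step, as integrating out the last step shows. The
  product runs over \<open>k<N\<close>, so the endpoint is weighted but not yet tested for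
  membership in \<open>D\<close>; this is what makes the induction close.\<close>

lemma walk_survival:
  fixes \<mu> :: "'a::euclidean_space measure" and w :: "'a \<Rightarrow> ennreal"
  assumes \<mu>: "prob_space \<mu>" and sets: "sets \<mu> = sets borel"
    and D [measurable]: "D \<in> sets borel" and w [measurable]: "w \<in> borel_measurable borel"
    and step: "\<And>y. y \<in> D \<Longrightarrow> (\<integral>\<^sup>+h. w (y + h) \<partial>\<mu>) \<le> \<rho> * w y"
  shows "(\<integral>\<^sup>+\<xi>. (\<Prod>k<N. indicator D (x + (\<Sum>i<k. \<xi> i))) * w (x + (\<Sum>i<N. \<xi> i)) \<partial>PiM {..<N} (\<lambda>_. \<mu>))
    \<le> \<rho> ^ N * w x"
proof (induction N)
  case 0
  interpret product_sigma_finite "\<lambda>_::nat. \<mu>"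
    using \<mu> by (simp add: product_sigma_finite_def prob_space_imp_sigma_finite)
  show ?case by (simp add: PiM_empty nn_integral_count_space_finite)
next
  case (Suc N)
  interpret product_sigma_finite "\<lambda>_::nat. \<mu>"
    using \<mu> by (simp add: product_sigma_finite_def prob_space_imp_sigma_finite)
  note [measurable_cong] = sets
  define S where "S k \<xi> = x + (\<Sum>i<k. \<xi> i)" for k and \<xi> :: "nat \<Rightarrow> 'a"
  have S [measurable]: "S k \<in> borel_measurable (PiM {..<n} (\<lambda>_. \<mu>))" if "k \<le> n" for k n
    unfolding S_def[abs_def] using that
    by (intro borel_measurable_add borel_measurable_const borel_measurable_sum)
      (auto intro!: measurable_component_singleton simp: measurable_cong_sets[OF refl sets[symmetric]])
  \<comment> \<open>Position \<open>k\<close> uses the steps below \<open>k\<close>, so coordinate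
    \<open>N\<close> enters position \<open>Suc N\<close> only.\<close>
  have upd: "S k (\<xi>(N := y)) = S k \<xi>" if "k \<le> N" for k \<xi> y
    unfolding S_def using that by (intro arg_cong2[where f="(+)"] sum.cong) auto
  have updN: "S (Suc N) (\<xi>(N := y)) = S N \<xi> + y" for \<xi> y
    using upd[of N \<xi> y] unfolding S_def by (simp add: add.assoc)
  have ins: "{..<Suc N} = insert N {..<N}" by auto
  have "(\<integral>\<^sup>+\<xi>. (\<Prod>k<Suc N. indicator D (S k \<xi>)) * w (S (Suc N) \<xi>) \<partial>PiM {..<Suc N} (\<lambda>_. \<mu>))
    = (\<integral>\<^sup>+\<xi>. (\<integral>\<^sup>+y. (\<Prod>k<Suc N. indicator D (S k (\<xi>(N := y)))) * w (S (Suc N) (\<xi>(N := y))) \<partial>\<mu>)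
         \<partial>PiM {..<N} (\<lambda>_. \<mu>))"
  proof -
    have "(\<lambda>\<xi>. (\<Prod>k<Suc N. indicator D (S k \<xi>)) * w (S (Suc N) \<xi>)) \<in> borel_measurable (PiM {..<Suc N} (\<lambda>_. \<mu>))"
    proof (intro borel_measurable_times_ennreal borel_measurable_prod_ennreal)
      fix k assume "k \<in> {..<Suc N}"
      then have [measurable]: "S k \<in> borel_measurable (PiM {..<Suc N} (\<lambda>_. \<mu>))" by (intro S) auto
      show "(\<lambda>\<xi>. indicator D (S k \<xi>) :: ennreal) \<in> borel_measurable (PiM {..<Suc N} (\<lambda>_. \<mu>))" by measurable
    next
      have [measurable]: "S (Suc N) \<in> borel_measurable (PiM {..<Suc N} (\<lambda>_. \<mu>))" by (intro S) auto
      show "(\<lambda>\<xi>. w (S (Suc N) \<xi>)) \<in> borel_measurable (PiM {..<Suc N} (\<lambda>_. \<mu>))" by measurable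
    qed
    then show ?thesis unfolding ins by (subst product_nn_integral_insert) auto
  qed
  also have "\<dots> = (\<integral>\<^sup>+\<xi>. (\<Prod>k<Suc N. indicator D (S k \<xi>)) * (\<integral>\<^sup>+y. w (S N \<xi> + y) \<partial>\<mu>) \<partial>PiM {..<N} (\<lambda>_. \<mu>))"
  proof (rule nn_integral_cong)
    fix \<xi> :: "nat \<Rightarrow> 'a"
    have "(\<Prod>k<Suc N. indicator D (S k (\<xi>(N := y)))) = (\<Prod>k<Suc N. indicator D (S k \<xi>) :: ennreal)" for y
      by (intro prod.cong refl) (simp add: upd)
    then show "(\<integral>\<^sup>+y. (\<Prod>k<Suc N. indicator D (S k (\<xi>(N := y)))) * w (S (Suc N) (\<xi>(N := y))) \<partial>\<mu>)
      = (\<Prod>k<Suc N. indicator D (S k \<xi>)) * (\<integral>\<^sup>+y. w (S N \<xi> + y) \<partial>\<mu>)"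
      unfolding updN by (simp only:) (rule nn_integral_cmult, measurable)
  qed
  also have "\<dots> \<le> (\<integral>\<^sup>+\<xi>. \<rho> * ((\<Prod>k<N. indicator D (S k \<xi>)) * w (S N \<xi>)) \<partial>PiM {..<N} (\<lambda>_. \<mu>))"
  proof (rule nn_integral_mono)
    fix \<xi> :: "nat \<Rightarrow> 'a"
    \<comment> \<open>The factor for \<open>k = N\<close> supplies the membership in
      \<open>D\<close> that \<open>step\<close> asks for; where it is 0 the left side
      vanishes.\<close>
    have "indicator D (S N \<xi>) * (\<integral>\<^sup>+y. w (S N \<xi> + y) \<partial>\<mu>) \<le> \<rho> * w (S N \<xi>)"
      using step[of "S N \<xi>"] by (auto simp: indicator_def)
    from mult_left_mono[OF this, of "\<Prod>k<N. indicator D (S k \<xi>)"]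
    show "(\<Prod>k<Suc N. indicator D (S k \<xi>)) * (\<integral>\<^sup>+y. w (S N \<xi> + y) \<partial>\<mu>)
      \<le> \<rho> * ((\<Prod>k<N. indicator D (S k \<xi>)) * w (S N \<xi>))"
      by (simp add: ac_simps)
  qed
  also have "\<dots> = \<rho> * (\<integral>\<^sup>+\<xi>. (\<Prod>k<N. indicator D (S k \<xi>)) * w (S N \<xi>) \<partial>PiM {..<N} (\<lambda>_. \<mu>))"
  proof (rule nn_integral_cmult)
    show "(\<lambda>\<xi>. (\<Prod>k<N. indicator D (S k \<xi>)) * w (S N \<xi>)) \<in> borel_measurable (PiM {..<N} (\<lambda>_. \<mu>))"
    proof (intro borel_measurable_times_ennreal borel_measurable_prod_ennreal)
      fix k assume "k \<in> {..<N}"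
      then have [measurable]: "S k \<in> borel_measurable (PiM {..<N} (\<lambda>_. \<mu>))" by (intro S) auto
      show "(\<lambda>\<xi>. indicator D (S k \<xi>) :: ennreal) \<in> borel_measurable (PiM {..<N} (\<lambda>_. \<mu>))" by measurable
    next
      have [measurable]: "S N \<in> borel_measurable (PiM {..<N} (\<lambda>_. \<mu>))" by (intro S) auto
      show "(\<lambda>\<xi>. w (S N \<xi>)) \<in> borel_measurable (PiM {..<N} (\<lambda>_. \<mu>))" by measurable
    qed
  qed
  also have "\<dots> \<le> \<rho> * (\<rho> ^ N * w x)"
    using Suc.IH unfolding S_def by (intro mult_left_mono) auto
  finally show ?case unfolding S_def by (simp add: mult.assoc)
qed

section \<open>Brownian motion sampled on a time grid\<close>

lemma brownian_increment_distr:
  assumes "brownian_motion M X" "0 \<le> s" "s < t"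
  shows "distr M borel (\<lambda>\<omega>. X t \<omega> - X s \<omega>) = gaussian (t - s)"
proof -
  have "distributed M lborel (\<lambda>\<omega>. X t \<omega> - X s \<omega>) (\<lambda>x. ennreal (gauss_density (t - s) x))"
    using assms unfolding brownian_motion_def by blast
  then have "distr M lborel (\<lambda>\<omega>. X t \<omega> - X s \<omega>) = density lborel (\<lambda>x. ennreal (gauss_density (t - s) x))"
    by (rule distributed_distr_eq_density)
  then show ?thesis unfolding gaussian_def by (simp cong: distr_cong)
qed

lemma brownian_measurable: "brownian_motion M X \<Longrightarrow> 0 \<le> t \<Longrightarrow> X t \<in> borel_measurable M"
  and brownian_0: "brownian_motion M X \<Longrightarrow> \<omega> \<in> space M \<Longrightarrow> X 0 \<omega> = 0"
  and brownian_continuous: "brownian_motion M X \<Longrightarrow> \<omega> \<in> space M \<Longrightarrow> continuous_on {0..} (\<lambda>t. X t \<omega>)"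
  and brownian_prob_space: "brownian_motion M X \<Longrightarrow> prob_space M"
  unfolding brownian_motion_def by blast+

text \<open>The sampled path is a walk with independent Gaussian steps, and the lower bound
  \<open>m\<close> of \<open>w\<close> on \<open>D\<close> turns the weighted estimate for the walk
  into one for the probability.\<close>

lemma brownian_grid_survival:
  fixes X :: "real \<Rightarrow> 'w \<Rightarrow> 'a::euclidean_space" and w :: "'a \<Rightarrow> ennreal"
  assumes X: "brownian_motion M X" and \<tau>: "\<tau> > 0"
    and D [measurable]: "D \<in> sets borel" and w [measurable]: "w \<in> borel_measurable borel"
    and step: "\<And>y. y \<in> D \<Longrightarrow> (\<integral>\<^sup>+h. w (y + h) \<partial>gaussian \<tau>) \<le> \<rho> * w y"
    and m: "\<And>y. y \<in> D \<Longrightarrow> m \<le> w y"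
  shows "m * emeasure M {\<omega>\<in>space M. \<forall>k\<le>N. x + X (real k * \<tau>) \<omega> \<in> D} \<le> \<rho> ^ N * w x"
proof -
  interpret prob_space M by (rule brownian_prob_space[OF X])
  have [measurable]: "X (real k * \<tau>) \<in> borel_measurable M" for k
    using \<tau> by (intro brownian_measurable[OF X]) auto
  define A where "A = {\<omega>\<in>space M. \<forall>k\<le>N. x + X (real k * \<tau>) \<omega> \<in> D}"
  have A [measurable]: "A \<in> sets M" unfolding A_def by measurable
  have "m * emeasure M A = (\<integral>\<^sup>+\<omega>. m * indicator A \<omega> \<partial>M)"
    by (simp add: nn_integral_cmult_indicator)
  also have "\<dots> \<le> (\<integral>\<^sup>+\<omega>. (\<Prod>k<N. indicator D (x + X (real k * \<tau>) \<omega>)) * w (x + X (real N * \<tau>) \<omega>) \<partial>M)"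
  proof (rule nn_integral_mono)
    fix \<omega>
    show "m * indicator A \<omega> \<le> (\<Prod>k<N. indicator D (x + X (real k * \<tau>) \<omega>)) * w (x + X (real N * \<tau>) \<omega>)"
    proof (cases "\<omega> \<in> A")
      case True
      then have "(\<Prod>k<N. indicator D (x + X (real k * \<tau>) \<omega>)) = (1 :: ennreal)"
        by (intro prod.neutral) (auto simp: A_def)
      then show ?thesis using True m[of "x + X (real N * \<tau>) \<omega>"] by (auto simp: A_def)
    qed simp
  qed
  also have "\<dots> \<le> \<rho> ^ N * w x"
  \<comment> \<open>\<open>indep_vars_iff_distr_eq_PiM\<close> requires a nonempty index
    set.\<close>
  proof (cases "N = 0")
    case True
    then show ?thesis using brownian_0[OF X] by (simp add: nn_integral_cong[of M _ "\<lambda>_. w x"] emeasure_space_1)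
  next
    case False
    define \<xi> where "\<xi> i \<omega> = X (real (Suc i) * \<tau>) \<omega> - X (real i * \<tau>) \<omega>" for i \<omega>
    have [measurable]: "\<xi> i \<in> borel_measurable M" for i unfolding \<xi>_def[abs_def] by measurable
    have "indep_vars (\<lambda>_. borel) \<xi> {..<N}"
    proof -
      have "\<forall>i<N. real i * \<tau> < real (Suc i) * \<tau>" using \<tau> by (simp add: algebra_simps)
      then have "indep_vars (\<lambda>_. borel) (\<lambda>i \<omega>. X (real (Suc i) * \<tau>) \<omega> - X (real i * \<tau>) \<omega>) {..<N}"
        using X[unfolded brownian_motion_def, THEN conjunct2, THEN conjunct2, THEN conjunct2, THEN conjunct2, THEN conjunct2,
            rule_format, of "\<lambda>i. real i * \<tau>" N] by simp
      then show ?thesis unfolding \<xi>_def[abs_def] .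
    qed
    then have "distr M (PiM {..<N} (\<lambda>_. borel)) (\<lambda>\<omega>. \<lambda>i\<in>{..<N}. \<xi> i \<omega>) = PiM {..<N} (\<lambda>i. distr M borel (\<xi> i))"
      using False by (subst (asm) indep_vars_iff_distr_eq_PiM) auto
    moreover have "distr M borel (\<xi> i) = gaussian \<tau>" for i
      using brownian_increment_distr[OF X, of "real i * \<tau>" "real (Suc i) * \<tau>"] \<tau>
      unfolding \<xi>_def[abs_def] by (simp add: algebra_simps)
    ultimately have distr: "distr M (PiM {..<N} (\<lambda>_. borel)) (\<lambda>\<omega>. \<lambda>i\<in>{..<N}. \<xi> i \<omega>) = PiM {..<N} (\<lambda>i. gaussian \<tau>)" by simp
    have tele: "X (real k * \<tau>) \<omega> = (\<Sum>i<k. \<xi> i \<omega>)" if "\<omega> \<in> space M" for k \<omega>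
      unfolding \<xi>_def using sum_lessThan_telescope[of "\<lambda>i. X (real i * \<tau>) \<omega>" k] brownian_0[OF X that] by simp
    have meas: "(\<lambda>f. (\<Prod>k<N. indicator D (x + (\<Sum>i<k. f i))) * w (x + (\<Sum>i<N. f i)))
        \<in> borel_measurable (PiM {..<N} (\<lambda>_. borel))"
    proof -
      have [measurable]: "(\<lambda>f. x + (\<Sum>i<k. f i)) \<in> borel_measurable (PiM {..<N} (\<lambda>_. borel))" if "k \<le> N" for k
        using that by (intro borel_measurable_add borel_measurable_const borel_measurable_sum measurable_component_singleton) auto
      show ?thesis
      proof (intro borel_measurable_times_ennreal borel_measurable_prod_ennreal)
        fix k assume "k \<in> {..<N}"
        then have [measurable]: "(\<lambda>f. x + (\<Sum>i<k. f i)) \<in> borel_measurable (PiM {..<N} (\<lambda>_. borel))" by simp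
        show "(\<lambda>f. indicator D (x + (\<Sum>i<k. f i)) :: ennreal) \<in> borel_measurable (PiM {..<N} (\<lambda>_. borel))" by measurable
      next
        have [measurable]: "(\<lambda>f. x + (\<Sum>i<N. f i)) \<in> borel_measurable (PiM {..<N} (\<lambda>_. borel))" by simp
        show "(\<lambda>f. w (x + (\<Sum>i<N. f i))) \<in> borel_measurable (PiM {..<N} (\<lambda>_. borel))" by measurable
      qed
    qed
    have "(\<integral>\<^sup>+\<omega>. (\<Prod>k<N. indicator D (x + X (real k * \<tau>) \<omega>)) * w (x + X (real N * \<tau>) \<omega>) \<partial>M)
      = (\<integral>\<^sup>+\<omega>. (\<Prod>k<N. indicator D (x + (\<Sum>i<k. (\<lambda>i\<in>{..<N}. \<xi> i \<omega>) i))) *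
            w (x + (\<Sum>i<N. (\<lambda>i\<in>{..<N}. \<xi> i \<omega>) i)) \<partial>M)"
      by (intro nn_integral_cong arg_cong2[where f="(*)"] prod.cong refl) (simp_all add: tele)
    also have "\<dots> = (\<integral>\<^sup>+f. (\<Prod>k<N. indicator D (x + (\<Sum>i<k. f i))) * w (x + (\<Sum>i<N. f i)) \<partial>PiM {..<N} (\<lambda>i. gaussian \<tau>))"
      unfolding distr[symmetric] using meas by (subst nn_integral_distr) auto
    also have "\<dots> \<le> \<rho> ^ N * w x"
      by (rule walk_survival) (auto intro!: prob_space_gaussian \<tau> step)
    finally show ?thesis .
  qed
  finally show ?thesis unfolding A_def .
qed

section \<open>Confinement to a ball\<close>

text \<open>Squared norm of the projection onto the span of \<open>B\<close>. One estimate then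
  covers the horizontal part of a motion in a product space as well as a real-valued motion, without
  constructing a projected process.\<close>

definition part_sq :: "'a::euclidean_space set \<Rightarrow> 'a \<Rightarrow> real" where
  "part_sq B x = (\<Sum>b\<in>B. (x \<bullet> b)\<^sup>2)"

lemma part_sq_nonneg: "0 \<le> part_sq B x"
  by (simp add: part_sq_def sum_nonneg)

lemma borel_measurable_part_sq [measurable]: "part_sq B \<in> borel_measurable borel"
  unfolding part_sq_def[abs_def] by measurable

lemma part_sq_add: "part_sq B (x + h) = part_sq B x + 2 * (\<Sum>b\<in>B. (x \<bullet> b) * (h \<bullet> b)) + part_sq B h"
  unfolding part_sq_def
  by (simp add: inner_add_left power2_sum sum.distrib sum_distrib_left mult.assoc)

lemma part_sq_minus: "part_sq B (- h) = part_sq B h"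
  by (simp add: part_sq_def)

text \<open>Averaging over \<open>h\<close> and \<open>- h\<close> removes the odd moments from the expectation of the quartic bound.\<close>

lemma gaussian_step_quartic:
  fixes x :: "'a::euclidean_space" and w :: "'a \<Rightarrow> real"
  assumes \<kappa>: "\<kappa> > 0" and \<delta>: "\<delta> > 0" and B: "B \<subseteq> Basis"
    and w [measurable]: "w \<in> borel_measurable borel" and w0: "\<And>y. 0 \<le> w y" and L: "L \<ge> 0"
    and bound: "\<And>h q. q = \<kappa>\<^sup>2 * part_sq B (x + h) - s \<Longrightarrow> w (x + h) \<le> a0 + a1 * q + a2 * q\<^sup>2 + L * q ^ 4"
    and s: "s = \<kappa>\<^sup>2 * part_sq B x" and n: "n = real (card B)"
  shows "(\<integral>\<^sup>+h. ennreal (w (x + h)) \<partial>gaussian (\<delta> / \<kappa>\<^sup>2))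
    \<le> ennreal (a0 + a1 * (n * \<delta>) + 4 * a2 * (\<delta> * s) + (\<bar>a2\<bar> + 128 * L * s\<^sup>2) * (3 * n\<^sup>2 * \<delta>\<^sup>2) + 840 * L * n ^ 4 * \<delta> ^ 4)"
proof -
  define t where "t = \<delta> / \<kappa>\<^sup>2"
  have t: "t > 0" using \<kappa> \<delta> by (simp add: t_def)
  have \<kappa>t: "\<kappa>\<^sup>2 * t = \<delta>" using \<kappa> by (simp add: t_def)
  have fin: "finite B" using B by (rule finite_subset) simp
  \<comment> \<open>The increment of \<open>s\<close> is \<open>2 * u h + v h\<close>, with
    \<open>u\<close> odd and \<open>v\<close> even in \<open>h\<close>.\<close>
  define u where "u h = \<kappa>\<^sup>2 * (\<Sum>b\<in>B. (x \<bullet> b) * (h \<bullet> b))" for h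
  define v where "v h = \<kappa>\<^sup>2 * part_sq B h" for h
  \<comment> \<open>By Cauchy-Schwarz, \<open>P2\<close> and \<open>P4\<close> dominate the square
    and the fourth power of \<open>v\<close>. Being sums of powers of single coordinates, they
    reduce the expectation to known even moments.\<close>
  define P2 where "P2 h = \<kappa> ^ 4 * n * (\<Sum>b\<in>B. (h \<bullet> b) ^ (2 * 2))" for h
  define P4 where "P4 h = \<kappa> ^ 8 * n ^ 3 * (\<Sum>b\<in>B. (h \<bullet> b) ^ (2 * 4))" for h
  have q: "\<kappa>\<^sup>2 * part_sq B (x + h) - s = 2 * u h + v h" for h
    unfolding part_sq_add s u_def v_def by (simp add: algebra_simps)
  have um: "u (- h) = - u h" and vm: "v (- h) = v h" for h
    by (simp_all add: u_def v_def part_sq_minus sum_negf)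
  have v0: "v h \<ge> 0" for h by (simp add: v_def part_sq_nonneg)
  have s0: "s \<ge> 0" unfolding s by (simp add: part_sq_nonneg)
  have n0: "n \<ge> 0" by (simp add: n)
  have cs: "(sum f B)\<^sup>2 \<le> n * (\<Sum>b\<in>B. (f b)\<^sup>2)" for f :: "'a \<Rightarrow> real"
    using sum_squared_le_sum_of_squares[of f B] fin n by (simp add: mult.commute)
  have v2: "(v h)\<^sup>2 \<le> P2 h" for h
  proof -
    have "(part_sq B h)\<^sup>2 \<le> n * (\<Sum>b\<in>B. ((h \<bullet> b)\<^sup>2)\<^sup>2)" unfolding part_sq_def by (rule cs)
    then have "\<kappa> ^ 4 * (part_sq B h)\<^sup>2 \<le> \<kappa> ^ 4 * (n * (\<Sum>b\<in>B. ((h \<bullet> b)\<^sup>2)\<^sup>2))"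
      by (rule mult_left_mono) simp
    then show ?thesis unfolding v_def P2_def
      by (simp add: power_mult_distrib power_mult[symmetric] mult.assoc)
  qed
  have v4: "v h ^ 4 \<le> P4 h" for h
  proof -
    have "v h ^ 4 = ((v h)\<^sup>2)\<^sup>2" by (simp add: power_mult[symmetric])
    also have "\<dots> \<le> (P2 h)\<^sup>2" by (intro power_mono v2) simp
    also have "\<dots> = \<kappa> ^ 8 * n\<^sup>2 * (\<Sum>b\<in>B. (h \<bullet> b) ^ (2 * 2))\<^sup>2"
      unfolding P2_def by (simp add: power_mult_distrib power_mult[symmetric])
    also have "\<dots> \<le> \<kappa> ^ 8 * n\<^sup>2 * (n * (\<Sum>b\<in>B. ((h \<bullet> b) ^ (2 * 2))\<^sup>2))"
      by (intro mult_left_mono cs) simp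
    also have "\<dots> = P4 h"
      unfolding P4_def by (simp add: power_mult[symmetric] power3_eq_cube power2_eq_square)
    finally show ?thesis .
  qed
  have u2: "(u h)\<^sup>2 \<le> s * v h" for h
  proof -
    have "(\<Sum>b\<in>B. (x \<bullet> b) * (h \<bullet> b))\<^sup>2 \<le> part_sq B x * part_sq B h"
      unfolding part_sq_def by (rule Cauchy_Schwarz_ineq_sum)
    then have "\<kappa> ^ 4 * (\<Sum>b\<in>B. (x \<bullet> b) * (h \<bullet> b))\<^sup>2 \<le> \<kappa> ^ 4 * (part_sq B x * part_sq B h)"
      by (rule mult_left_mono) simp
    then show ?thesis unfolding u_def v_def s
      by (simp add: power_mult_distrib power_mult[symmetric] ac_simps)
  qed
  \<comment> \<open>Half of the bound for the symmetrised function: 128 and 8 are half of 256 and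
    16, which come from \<open>(a + b) ^ 4 + (a - b) ^ 4 \<le> 16 * a ^ 4 + 16 * b ^ 4\<close> at
    \<open>a = 2 * u h\<close>, \<open>b = v h\<close>.\<close>
  define T where "T h = a0 + a1 * v h + 4 * a2 * (u h)\<^sup>2 + (\<bar>a2\<bar> + 128 * L * s\<^sup>2) * P2 h + 8 * L * P4 h" for h
  have wT: "w (x + h) + w (x - h) \<le> 2 * T h" for h
  proof -
    have "w (x + h) + w (x + - h) \<le> (a0 + a1 * (2 * u h + v h) + a2 * (2 * u h + v h)\<^sup>2 + L * (2 * u h + v h) ^ 4)
      + (a0 + a1 * (2 * u (- h) + v (- h)) + a2 * (2 * u (- h) + v (- h))\<^sup>2 + L * (2 * u (- h) + v (- h)) ^ 4)"
      by (intro add_mono bound) (simp_all only: q)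
    also have "\<dots> = 2 * (a0 + a1 * v h + 4 * a2 * (u h)\<^sup>2 + a2 * (v h)\<^sup>2) +
       L * ((2 * u h + v h) ^ 4 + (2 * u h - v h) ^ 4)"
      unfolding um vm by algebra
    also have "\<dots> \<le> 2 * (a0 + a1 * v h + 4 * a2 * (u h)\<^sup>2 + \<bar>a2\<bar> * P2 h) +
       L * (256 * (s\<^sup>2 * P2 h) + 16 * P4 h)"
    proof -
      have "a2 * (v h)\<^sup>2 \<le> \<bar>a2\<bar> * (v h)\<^sup>2" by (intro mult_right_mono) auto
      also have "\<dots> \<le> \<bar>a2\<bar> * P2 h" by (intro mult_left_mono v2) auto
      finally have F1: "a2 * (v h)\<^sup>2 \<le> \<bar>a2\<bar> * P2 h" .
      have "(u h) ^ 4 = ((u h)\<^sup>2)\<^sup>2" by (simp add: power_mult[symmetric])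
      also have "\<dots> \<le> (s * v h)\<^sup>2" by (intro power_mono u2) simp
      also have "\<dots> \<le> s\<^sup>2 * P2 h" unfolding power_mult_distrib by (intro mult_left_mono v2) simp
      finally have u4: "u h ^ 4 \<le> s\<^sup>2 * P2 h" .
      have "(a + b) ^ 4 + (a - b) ^ 4 \<le> 16 * a ^ 4 + 16 * b ^ 4" for a b :: real
      proof -
        have "16 * a ^ 4 + 16 * b ^ 4 - ((a + b) ^ 4 + (a - b) ^ 4) = 6 * (a\<^sup>2 - b\<^sup>2)\<^sup>2 + 8 * (a\<^sup>2)\<^sup>2 + 8 * (b\<^sup>2)\<^sup>2"
          by algebra
        also have "\<dots> \<ge> 0" by simp
        finally show ?thesis by simp
      qed
      from this[of "2 * u h" "v h"]
      have "(2 * u h + v h) ^ 4 + (2 * u h - v h) ^ 4 \<le> 256 * (s\<^sup>2 * P2 h) + 16 * P4 h"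
        using u4 v4[of h] by (simp add: power_mult_distrib)
      from mult_left_mono[OF this L] F1 show ?thesis by simp
    qed
    also have "\<dots> = 2 * T h" unfolding T_def by (simp add: algebra_simps)
    finally show ?thesis by simp
  qed
  interpret prob_space "gaussian t :: 'a measure" by (rule prob_space_gaussian[OF t])
  have mom: "has_bochner_integral (gaussian t) (\<lambda>h. (h \<bullet> b) ^ (2 * k)) (fact (2 * k) / ((2 / t) ^ k * fact k))"
    if "b \<in> B" for b k
    using gaussian_even_moment[OF t, of b k] that B by (auto simp: has_bochner_integral_iff)
  have v_int: "has_bochner_integral (gaussian t) v (n * \<delta>)"
  proof -
    have "has_bochner_integral (gaussian t) (\<lambda>h. \<kappa>\<^sup>2 * (\<Sum>b\<in>B. (h \<bullet> b) ^ (2 * 1))) (\<kappa>\<^sup>2 * (\<Sum>b\<in>B. fact (2 * 1) / ((2 / t) ^ 1 * fact 1)))"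
      by (intro has_bochner_integral_mult_right has_bochner_integral_sum mom)
    moreover have "\<kappa>\<^sup>2 * (\<Sum>b\<in>B. fact (2 * 1) / ((2 / t) ^ 1 * fact 1)) = n * (\<kappa>\<^sup>2 * t)" by (simp add: n)
    ultimately show ?thesis unfolding \<kappa>t by (simp add: v_def[abs_def] part_sq_def)
  qed
  have P2_int: "has_bochner_integral (gaussian t) P2 (3 * n\<^sup>2 * \<delta>\<^sup>2)"
  proof -
    have "has_bochner_integral (gaussian t) P2 (\<kappa> ^ 4 * n * (\<Sum>b\<in>B. fact (2 * 2) / ((2 / t) ^ 2 * fact 2)))"
      unfolding P2_def[abs_def] by (intro has_bochner_integral_mult_right has_bochner_integral_sum mom)
    moreover have "\<kappa> ^ 4 * n * (\<Sum>b\<in>B. fact (2 * 2) / ((2 / t) ^ 2 * fact 2)) = 3 * n\<^sup>2 * (\<kappa>\<^sup>2 * t)\<^sup>2"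
      using t by (simp add: n fact_numeral field_simps power2_eq_square power4_eq_xxxx)
    ultimately show ?thesis unfolding \<kappa>t by simp
  qed
  \<comment> \<open>105 is the eighth moment of the standard normal law; with the factor 8 in
    \<open>T\<close> it becomes the 840 of the statement.\<close>
  have P4_int: "has_bochner_integral (gaussian t) P4 (105 * n ^ 4 * \<delta> ^ 4)"
  proof -
    have "has_bochner_integral (gaussian t) P4 (\<kappa> ^ 8 * n ^ 3 * (\<Sum>b\<in>B. fact (2 * 4) / ((2 / t) ^ 4 * fact 4)))"
      unfolding P4_def[abs_def] by (intro has_bochner_integral_mult_right has_bochner_integral_sum mom)
    moreover have "\<kappa> ^ 8 * n ^ 3 * (\<Sum>b\<in>B. fact (2 * 4) / ((2 / t) ^ 4 * fact 4)) = 105 * n ^ 4 * (\<kappa>\<^sup>2 * t) ^ 4"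
    proof -
      have "fact (2 * 4) / ((2 / t) ^ 4 * fact 4) = 105 * t ^ 4"
        using t by (simp add: fact_numeral field_simps)
      then show ?thesis by (simp add: n power_mult_distrib power_mult[symmetric] eval_nat_numeral)
    qed
    ultimately show ?thesis unfolding \<kappa>t by simp
  qed
  have u_int: "has_bochner_integral (gaussian t) (\<lambda>h. (u h)\<^sup>2) (\<delta> * s)"
  proof -
    have "has_bochner_integral (gaussian t) (\<lambda>h. \<kappa> ^ 4 * (\<Sum>b\<in>B. (x \<bullet> b) * (h \<bullet> b))\<^sup>2)
        (\<kappa> ^ 4 * (t * (\<Sum>b\<in>B. (x \<bullet> b)\<^sup>2)))"
      using gaussian_quadratic_moment[OF t B, of x]
      by (intro has_bochner_integral_mult_right) (auto simp: has_bochner_integral_iff)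
    moreover have "\<kappa> ^ 4 * (t * (\<Sum>b\<in>B. (x \<bullet> b)\<^sup>2)) = (\<kappa>\<^sup>2 * t) * s"
      unfolding s part_sq_def by (simp add: power2_eq_square power4_eq_xxxx)
    ultimately show ?thesis unfolding \<kappa>t by (simp add: u_def[abs_def] power_mult_distrib)
  qed
  have T_int: "has_bochner_integral (gaussian t) T (a0 + a1 * (n * \<delta>) + 4 * a2 * (\<delta> * s)
     + (\<bar>a2\<bar> + 128 * L * s\<^sup>2) * (3 * n\<^sup>2 * \<delta>\<^sup>2) + 8 * L * (105 * n ^ 4 * \<delta> ^ 4))"
    unfolding T_def[abs_def]
    by (intro has_bochner_integral_add has_bochner_integral_mult_right v_int u_int P2_int P4_int)
      (simp add: has_bochner_integral_iff prob_space[simplified])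
  have T0: "T h \<ge> 0" for h using wT[of h] w0[of "x + h"] w0[of "x - h"] by linarith
  have "(\<integral>\<^sup>+h. ennreal (w (x - h)) \<partial>gaussian t) = (\<integral>\<^sup>+h. ennreal (w (x + h)) \<partial>distr (gaussian t) borel uminus)"
    by (subst nn_integral_distr) auto
  then have sym: "(\<integral>\<^sup>+h. ennreal (w (x - h)) \<partial>gaussian t) = (\<integral>\<^sup>+h. ennreal (w (x + h)) \<partial>gaussian t)"
    by (simp add: distr_gaussian_uminus)
  have "2 * (\<integral>\<^sup>+h. ennreal (w (x + h)) \<partial>gaussian t)
     = (\<integral>\<^sup>+h. ennreal (w (x + h)) \<partial>gaussian t) + (\<integral>\<^sup>+h. ennreal (w (x - h)) \<partial>gaussian t)"
    by (simp add: sym mult_2)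
  also have "\<dots> = (\<integral>\<^sup>+h. ennreal (w (x + h)) + ennreal (w (x - h)) \<partial>gaussian t)"
    by (intro nn_integral_add[symmetric]) auto
  also have "\<dots> \<le> (\<integral>\<^sup>+h. 2 * ennreal (T h) \<partial>gaussian t)"
  proof (rule nn_integral_mono)
    fix h
    have "ennreal (w (x + h)) + ennreal (w (x - h)) = ennreal (w (x + h) + w (x - h))"
      by (simp add: w0)
    also have "\<dots> \<le> ennreal (2 * T h)" by (intro ennreal_leI wT)
    finally show "ennreal (w (x + h)) + ennreal (w (x - h)) \<le> 2 * ennreal (T h)"
      by (simp add: ennreal_mult' T0)
  qed
  also have "\<dots> = 2 * (\<integral>\<^sup>+h. ennreal (T h) \<partial>gaussian t)"
    using T_int by (intro nn_integral_cmult) (auto simp: has_bochner_integral_iff)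
  also have "(\<integral>\<^sup>+h. ennreal (T h) \<partial>gaussian t) = ennreal (a0 + a1 * (n * \<delta>) + 4 * a2 * (\<delta> * s)
     + (\<bar>a2\<bar> + 128 * L * s\<^sup>2) * (3 * n\<^sup>2 * \<delta>\<^sup>2) + 8 * L * (105 * n ^ 4 * \<delta> ^ 4))"
    using T_int T0 by (subst nn_integral_eq_integral) (auto simp: has_bochner_integral_iff)
  finally have "2 * (\<integral>\<^sup>+h. ennreal (w (x + h)) \<partial>gaussian t) \<le> 2 * \<dots>" .
  then have "(\<integral>\<^sup>+h. ennreal (w (x + h)) \<partial>gaussian t) \<le> ennreal (a0 + a1 * (n * \<delta>) + 4 * a2 * (\<delta> * s)
     + (\<bar>a2\<bar> + 128 * L * s\<^sup>2) * (3 * n\<^sup>2 * \<delta>\<^sup>2) + 8 * L * (105 * n ^ 4 * \<delta> ^ 4))"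
    by (subst (asm) ennreal_mult_le_mult_iff) auto
  then show ?thesis unfolding t_def by (simp add: mult.assoc)
qed

text \<open>The cut-off is harmless for an upper bound: up to \<rho>1 it only removes positive
  values. Beyond \<rho>1 the increment is at least the gap \<open>\<rho>1 - \<rho>0\<close>, and
  there the cubic term outweighs the linear and quadratic ones.\<close>

lemma bessel_Phi_cubic_bound:
  assumes d: "d > 0" and \<rho>: "0 < \<rho>0" "\<rho>0 < \<rho>1"
    and pos: "\<And>s. 0 \<le> s \<Longrightarrow> s \<le> \<rho>1 \<Longrightarrow> bessel_Phi d s > 0"
  obtains K where "K \<ge> 0"
    "\<And>s q. 0 \<le> s \<Longrightarrow> s \<le> \<rho>0 \<Longrightarrow> 0 \<le> s + q \<Longrightarrow>
      (if s + q \<le> \<rho>0 then bessel_Phi d (s + q) else 0)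
        \<le> bessel_Phi d s - bessel_Phi (d + 1) s / 4 * q + bessel_Phi (d + 2) s / 32 * q\<^sup>2 + K * \<bar>q\<bar> ^ 3"
proof -
  \<comment> \<open>The intermediate point of Maclaurin's formula is only known to satisfy
    \<open>\<bar>y\<bar> \<le> \<bar>q\<bar>\<close>, so \<open>s + y\<close> may be negative or
    exceed \<rho>1; this interval still contains it.\<close>
  have bdd: "\<exists>M\<ge>0. \<forall>s\<in>{- \<rho>1..2 * \<rho>1}. \<bar>bessel_Phi c s\<bar> \<le> M" if "c > 0" for c
  proof -
    have "bounded (bessel_Phi c ` {- \<rho>1..2 * \<rho>1})"
      using that by (intro compact_imp_bounded compact_continuous_image continuous_bessel_Phi) auto
    then obtain M where "\<forall>s\<in>{- \<rho>1..2 * \<rho>1}. \<bar>bessel_Phi c s\<bar> \<le> M" by (auto simp: bounded_iff)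
    then show ?thesis by (intro exI[of _ "max M 0"]) auto
  qed
  obtain M1 where M1: "M1 \<ge> 0" "\<And>s. s\<in>{- \<rho>1..2 * \<rho>1} \<Longrightarrow> \<bar>bessel_Phi (d + 1) s\<bar> \<le> M1"
    using bdd[of "d + 1"] d by auto
  obtain M2 where M2: "M2 \<ge> 0" "\<And>s. s\<in>{- \<rho>1..2 * \<rho>1} \<Longrightarrow> \<bar>bessel_Phi (d + 2) s\<bar> \<le> M2"
    using bdd[of "d + 2"] d by auto
  obtain M3 where M3: "M3 \<ge> 0" "\<And>s. s\<in>{- \<rho>1..2 * \<rho>1} \<Longrightarrow> \<bar>bessel_Phi (d + 3) s\<bar> \<le> M3"
    using bdd[of "d + 3"] d by auto
  define g where "g = \<rho>1 - \<rho>0"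
  have g: "g > 0" using \<rho> by (simp add: g_def)
  \<comment> \<open>\<open>M3\<close> pays for the Taylor remainder; the other summands absorb the
    first and second order terms when \<open>q \<ge> g\<close>.\<close>
  define K where "K = M3 + M1 / g\<^sup>2 + M2 / g"
  show thesis
  proof (rule that)
    show "K \<ge> 0" using M1(1) M2(1) M3(1) g by (simp add: K_def)
    fix s q :: real assume s: "0 \<le> s" "s \<le> \<rho>0" and sq: "0 \<le> s + q"
    show "(if s + q \<le> \<rho>0 then bessel_Phi d (s + q) else 0)
        \<le> bessel_Phi d s - bessel_Phi (d + 1) s / 4 * q + bessel_Phi (d + 2) s / 32 * q\<^sup>2 + K * \<bar>q\<bar> ^ 3"
    proof (cases "s + q \<le> \<rho>1")
      case True
      define D where "D m h = (- 1 / 4) ^ m * bessel_Phi (d + real m) (s + h)" for m h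
      have "(D m has_real_derivative D (Suc m) h) (at h)" for m h
        unfolding D_def[abs_def] using d
        by (auto intro!: derivative_eq_intros DERIV_bessel_Phi_chain simp: ac_simps)
      then obtain y where y: "\<bar>y\<bar> \<le> \<bar>q\<bar>" "D 0 q = (\<Sum>m<3. (D m 0 / fact m) * q ^ m) + D 3 y / fact 3 * q ^ 3"
        using Maclaurin_bi_le[of D "D 0" 3 q] by auto
      have "D 3 y / fact 3 * q ^ 3 \<le> M3 * \<bar>q\<bar> ^ 3"
      proof -
        have "\<bar>bessel_Phi (d + 3) (s + y)\<bar> \<le> M3" using y(1) True s sq \<rho> by (intro M3(2)) auto
        then have "\<bar>D 3 y / fact 3\<bar> \<le> M3" using M3(1)
            by (simp add: D_def abs_mult fact_numeral power_abs power_divide)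
        then have "\<bar>D 3 y / fact 3 * q ^ 3\<bar> \<le> M3 * \<bar>q\<bar> ^ 3"
          unfolding abs_mult power_abs by (intro mult_right_mono) auto
        then show ?thesis by linarith
      qed
      moreover have "M3 * \<bar>q\<bar> ^ 3 \<le> K * \<bar>q\<bar> ^ 3"
        using M1(1) M2(1) g by (intro mult_right_mono) (auto simp: K_def)
      moreover have "(\<Sum>m<3. (D m 0 / fact m) * q ^ m)
          = bessel_Phi d s - bessel_Phi (d + 1) s / 4 * q + bessel_Phi (d + 2) s / 32 * q\<^sup>2"
        by (simp add: D_def eval_nat_numeral)
      ultimately have "bessel_Phi d (s + q) \<le> bessel_Phi d s - bessel_Phi (d + 1) s / 4 * q
          + bessel_Phi (d + 2) s / 32 * q\<^sup>2 + K * \<bar>q\<bar> ^ 3"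
        using y(2) by (simp add: D_def)
      \<comment> \<open>Between \<rho>0 and \<rho>1 the left side is 0, while the right side is at
        least the positive value \<open>bessel_Phi d (s + q)\<close>.\<close>
      then show ?thesis using pos[OF sq True] by auto
    next
      case False
      then have q: "q \<ge> g" using s by (simp add: g_def)
      have q0: "q > 0" using q g by simp
      have "s \<in> {- \<rho>1..2 * \<rho>1}" using s \<rho> by auto
      note M = M1(2)[OF this] M2(2)[OF this]
      have "bessel_Phi (d + 1) s / 4 * q \<le> M1 * q" using M(1) M1(1) q0 by (intro mult_right_mono) auto
      also have "\<dots> \<le> M1 / g\<^sup>2 * q ^ 3"
      proof -
        have "g\<^sup>2 \<le> q\<^sup>2" using q g by (intro power_mono) auto
        then have "M1 * q * g\<^sup>2 \<le> M1 * q * q\<^sup>2" using M1(1) q0 by (intro mult_left_mono) auto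
        then show ?thesis using g by (simp add: field_simps power3_eq_cube power2_eq_square)
      qed
      finally have b1: "bessel_Phi (d + 1) s / 4 * q \<le> M1 / g\<^sup>2 * q ^ 3" .
      have "- (bessel_Phi (d + 2) s / 32 * q\<^sup>2) \<le> M2 * q\<^sup>2"
        unfolding minus_mult_left using M(2) M2(1) by (intro mult_right_mono) auto
      also have "\<dots> \<le> M2 / g * q ^ 3"
      proof -
        have "M2 * q\<^sup>2 * g \<le> M2 * q\<^sup>2 * q" using q M2(1) by (intro mult_left_mono) auto
        then show ?thesis using g by (simp add: field_simps power3_eq_cube power2_eq_square)
      qed
      finally have b2: "- (bessel_Phi (d + 2) s / 32 * q\<^sup>2) \<le> M2 / g * q ^ 3" .
      have b3: "0 \<le> M3 * q ^ 3" using M3(1) q0 by simp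
      have "K * \<bar>q\<bar> ^ 3 = M3 * q ^ 3 + M1 / g\<^sup>2 * q ^ 3 + M2 / g * q ^ 3"
        using q0 by (simp add: K_def distrib_right)
      moreover have "bessel_Phi d s > 0" using s \<rho> by (intro pos) auto
      moreover have "\<not> s + q \<le> \<rho>0" using False \<rho> by simp
      ultimately show ?thesis using b1 b2 b3 by simp
    qed
  qed
qed

text \<open>Half the Laplacian multiplies the eigenfunction by
  \<open>- \<kappa>\<^sup>2 / 2\<close>, so a step of duration
  \<open>\<delta> / \<kappa>\<^sup>2\<close> should produce the factor
  \<open>1 - \<delta> / 2\<close>, with an error of order \<open>\<delta> powr (3 / 2)\<close>.
  Hence every rate \<gamma> below 1/2 is reached for small \<delta>. By scaling, \<delta> does not
  depend on \<kappa>, that is, on the radius of the ball.\<close>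

lemma bessel_step:
  fixes B :: "'a::euclidean_space set"
  assumes B: "B \<subseteq> Basis" "B \<noteq> {}" and d: "d = real (card B) / 2"
    and \<rho>: "0 < \<rho>0" "\<rho>0 < \<rho>1"
    and pos: "\<And>s. 0 \<le> s \<Longrightarrow> s \<le> \<rho>1 \<Longrightarrow> bessel_Phi d s > 0"
    and \<gamma>: "\<gamma> < 1 / 2"
  defines "w \<equiv> \<lambda>\<kappa> y. if \<kappa>\<^sup>2 * part_sq B y \<le> \<rho>0 then bessel_Phi d (\<kappa>\<^sup>2 * part_sq B y) else 0"
  obtains \<delta> where "\<delta> > 0"
    "\<And>\<kappa> x. \<kappa> > 0 \<Longrightarrow> \<kappa>\<^sup>2 * part_sq B x \<le> \<rho>0 \<Longrightarrow>
      (\<integral>\<^sup>+h. ennreal (w \<kappa> (x + h)) \<partial>gaussian (\<delta> / \<kappa>\<^sup>2)) \<le> ennreal (exp (- \<gamma> * \<delta>)) * ennreal (w \<kappa> x)"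
proof -
  have fin: "finite B" using B(1) by (rule finite_subset) simp
  then have d0: "d > 0" using B(2) by (simp add: d card_gt_0_iff)
  define n where "n = real (card B)"
  have n0: "n \<ge> 0" by (simp add: n_def)
  obtain K where K: "K \<ge> 0"
    "\<And>s q. 0 \<le> s \<Longrightarrow> s \<le> \<rho>0 \<Longrightarrow> 0 \<le> s + q \<Longrightarrow>
      (if s + q \<le> \<rho>0 then bessel_Phi d (s + q) else 0)
        \<le> bessel_Phi d s - bessel_Phi (d + 1) s / 4 * q + bessel_Phi (d + 2) s / 32 * q\<^sup>2 + K * \<bar>q\<bar> ^ 3"
    using bessel_Phi_cubic_bound[OF d0 \<rho> pos] by metis
  obtain s0 where s0: "s0 \<in> {0..\<rho>0}" "\<And>s. s \<in> {0..\<rho>0} \<Longrightarrow> bessel_Phi d s0 \<le> bessel_Phi d s"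
    using continuous_attains_inf[of "{0..\<rho>0}" "bessel_Phi d"] continuous_bessel_Phi[OF d0] \<rho>(1) by auto
  define m where "m = bessel_Phi d s0"
  have m: "m > 0" unfolding m_def using s0(1) \<rho> by (intro pos) auto
  have "bounded (bessel_Phi (d + 2) ` {0..\<rho>0})"
    using d0 by (intro compact_imp_bounded compact_continuous_image continuous_bessel_Phi) auto
  then obtain M2 where M2: "\<And>s. s \<in> {0..\<rho>0} \<Longrightarrow> \<bar>bessel_Phi (d + 2) s\<bar> \<le> M2"
    unfolding bounded_iff by (metis imageI real_norm_def)
  have M20: "M2 \<ge> 0" using M2[of 0] \<rho> by force
  \<comment> \<open>Coefficient of \<open>r ^ 3\<close> in the total error; its summands are those
    of \<open>e1\<close> to \<open>e4\<close> below.\<close>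
  define C where "C = 2 * K * \<rho>0 + (M2 + K) * (3 * n\<^sup>2) + 192 * K * \<rho>0\<^sup>2 * n\<^sup>2 + 420 * K * n ^ 4"
  have C: "C \<ge> 0" unfolding C_def using K(1) M20 \<rho> by simp
  \<comment> \<open>Square root of the step length. \<open>r \<le> 1\<close> reduces higher powers
    to \<open>r ^ 3\<close>; the other bound makes \<open>C * r\<close> at most the slack
    \<open>1 / 2 - \<gamma>\<close> times the minimum of the eigenfunction.\<close>
  define r where "r = min 1 ((1 / 2 - \<gamma>) * m / (C + 1))"
  have r: "r > 0" "r \<le> 1" unfolding r_def using \<gamma> m C by auto
  have Cr: "C * r \<le> (1 / 2 - \<gamma>) * m"
  proof -
    have "C * r \<le> (C + 1) * r" using r by simp
    also have "\<dots> \<le> (C + 1) * ((1 / 2 - \<gamma>) * m / (C + 1))" using C by (intro mult_left_mono) (auto simp: r_def)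
    finally show ?thesis using C by simp
  qed
  show thesis
  proof (rule that[of "r\<^sup>2"])
    show "r\<^sup>2 > 0" using r by simp
    fix \<kappa> :: real and x :: 'a assume \<kappa>: "\<kappa> > 0" and x: "\<kappa>\<^sup>2 * part_sq B x \<le> \<rho>0"
    define s where "s = \<kappa>\<^sup>2 * part_sq B x"
    have s: "0 \<le> s" "s \<le> \<rho>0" using x by (auto simp: s_def part_sq_nonneg)
    define a1 where "a1 = - bessel_Phi (d + 1) s / 4"
    define a2 where "a2 = bessel_Phi (d + 2) s / 32 + K * r / 2"
    define L where "L = K / (2 * r)"
    have meas [measurable]: "w \<kappa> \<in> borel_measurable borel"
    proof -
      have [measurable]: "bessel_Phi d \<in> borel_measurable borel"
        by (intro borel_measurable_continuous_onI continuous_bessel_Phi d0)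
      show ?thesis unfolding w_def by measurable
    qed
    have w0: "0 \<le> w \<kappa> y" for y
      unfolding w_def using pos[of "\<kappa>\<^sup>2 * part_sq B y"] \<rho> by (auto simp: part_sq_nonneg less_imp_le)
    have "(\<integral>\<^sup>+h. ennreal (w \<kappa> (x + h)) \<partial>gaussian (r\<^sup>2 / \<kappa>\<^sup>2))
      \<le> ennreal (bessel_Phi d s + a1 * (n * r\<^sup>2) + 4 * a2 * (r\<^sup>2 * s)
          + (\<bar>a2\<bar> + 128 * L * s\<^sup>2) * (3 * n\<^sup>2 * (r\<^sup>2)\<^sup>2) + 840 * L * n ^ 4 * (r\<^sup>2) ^ 4)"
    proof (rule gaussian_step_quartic[OF \<kappa> _ B(1) meas w0 _ _ s_def n_def])
      show "0 < r\<^sup>2" "0 \<le> L" using r K(1) by (auto simp: L_def)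
      fix h q assume q: "q = \<kappa>\<^sup>2 * part_sq B (x + h) - s"
      have "w \<kappa> (x + h) = (if s + q \<le> \<rho>0 then bessel_Phi d (s + q) else 0)" by (simp add: w_def q)
      also have "\<dots> \<le> bessel_Phi d s - bessel_Phi (d + 1) s / 4 * q + bessel_Phi (d + 2) s / 32 * q\<^sup>2 + K * \<bar>q\<bar> ^ 3"
        using s by (intro K(2)) (auto simp: q part_sq_nonneg)
      \<comment> \<open>\<open>gaussian_step_quartic\<close> admits no cubic term. The inequality of
        the means with weight \<open>r\<close> splits it into two even powers, each of expectation
        of order \<open>r ^ 3\<close>.\<close>
      also have "K * \<bar>q\<bar> ^ 3 \<le> K * ((r * q\<^sup>2 + q ^ 4 / r) / 2)"
      proof (intro mult_left_mono K(1))
        have "2 * r * \<bar>q\<bar> \<le> r\<^sup>2 + q\<^sup>2" using sum_squares_bound[of r "\<bar>q\<bar>"] by simp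
        then have "\<bar>q\<bar> \<le> (r + q\<^sup>2 / r) / 2" using r by (simp add: field_simps power2_eq_square)
        then have "q\<^sup>2 * \<bar>q\<bar> \<le> q\<^sup>2 * ((r + q\<^sup>2 / r) / 2)" by (intro mult_left_mono) auto
        moreover have "\<bar>q\<bar> ^ 3 = q\<^sup>2 * \<bar>q\<bar>" by (simp add: power3_eq_cube power2_eq_square flip: abs_mult)
        moreover have "q\<^sup>2 * ((r + q\<^sup>2 / r) / 2) = (r * q\<^sup>2 + q ^ 4 / r) / 2"
          using r by (simp add: field_simps power2_eq_square power4_eq_xxxx)
        ultimately show "\<bar>q\<bar> ^ 3 \<le> (r * q\<^sup>2 + q ^ 4 / r) / 2" by simp
      qed
      finally show "w \<kappa> (x + h) \<le> bessel_Phi d s + a1 * q + a2 * q\<^sup>2 + L * q ^ 4"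
        using r by (simp add: a1_def a2_def L_def field_simps)
    qed
    also have "\<dots> \<le> ennreal (exp (- \<gamma> * r\<^sup>2) * bessel_Phi d s)"
    proof (rule ennreal_leI)
      \<comment> \<open>Half of the eigenvalue equation, with the dimension
        \<open>n = 2 * d\<close>.\<close>
      have ode: "a1 * n + bessel_Phi (d + 2) s / 8 * s = - bessel_Phi d s / 2"
      proof -
        have "n = 2 * d" by (simp add: n_def d)
        then show ?thesis using bessel_Phi_recurrence[OF d0, of s] by (simp add: a1_def mult.commute[of s])
      qed
      have main: "bessel_Phi d s + a1 * (n * r\<^sup>2) + 4 * a2 * (r\<^sup>2 * s)
        = bessel_Phi d s - r\<^sup>2 * (bessel_Phi d s / 2) + r ^ 3 * (2 * K * s)"
      proof -
        have "bessel_Phi d s + a1 * (n * r\<^sup>2) + 4 * a2 * (r\<^sup>2 * s)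
          = bessel_Phi d s + r\<^sup>2 * (a1 * n + bessel_Phi (d + 2) s / 8 * s) + r ^ 3 * (2 * K * s)"
          unfolding a2_def by (simp add: algebra_simps power3_eq_cube power2_eq_square)
        then show ?thesis unfolding ode by simp
      qed
      have p: "r ^ j \<le> r ^ 3" if "j \<ge> 3" for j using r that by (intro power_decreasing) auto
      have r3: "r ^ 3 \<ge> 0" using r by simp
      have e1: "r ^ 3 * (2 * K * s) \<le> r ^ 3 * (2 * K * \<rho>0)"
        using s K(1) r3 by (intro mult_left_mono) auto
      have e2: "\<bar>a2\<bar> * (3 * n\<^sup>2 * (r\<^sup>2)\<^sup>2) \<le> r ^ 3 * ((M2 + K) * (3 * n\<^sup>2))"
      proof -
        have "K * r \<le> K * 1" using K(1) r by (intro mult_left_mono) auto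
        moreover have "0 \<le> K * r" using K(1) r by simp
        ultimately have "\<bar>a2\<bar> \<le> M2 + K" unfolding a2_def using M2[of s] s by (simp add: abs_le_iff)
        then have "\<bar>a2\<bar> * (3 * n\<^sup>2 * (r\<^sup>2)\<^sup>2) \<le> (M2 + K) * (3 * n\<^sup>2 * r ^ 3)"
          using p[of 4] M20 K(1) n0 by (intro mult_mono) (auto simp: power_mult[symmetric])
        then show ?thesis by (simp add: ac_simps)
      qed
      have e3: "128 * L * s\<^sup>2 * (3 * n\<^sup>2 * (r\<^sup>2)\<^sup>2) \<le> r ^ 3 * (192 * K * \<rho>0\<^sup>2 * n\<^sup>2)"
      proof -
        have "128 * L * s\<^sup>2 * (3 * n\<^sup>2 * (r\<^sup>2)\<^sup>2) = r ^ 3 * (192 * K * s\<^sup>2 * n\<^sup>2)"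
          using r by (simp add: L_def field_simps power2_eq_square power3_eq_cube)
        also have "\<dots> \<le> r ^ 3 * (192 * K * \<rho>0\<^sup>2 * n\<^sup>2)"
          using r3 K(1) s by (intro mult_left_mono mult_right_mono power_mono) auto
        finally show ?thesis .
      qed
      have e4: "840 * L * n ^ 4 * (r\<^sup>2) ^ 4 \<le> r ^ 3 * (420 * K * n ^ 4)"
      proof -
        have "840 * L * n ^ 4 * (r\<^sup>2) ^ 4 = r ^ 7 * (420 * K * n ^ 4)"
          using r by (simp add: L_def field_simps eval_nat_numeral)
        also have "\<dots> \<le> r ^ 3 * (420 * K * n ^ 4)"
          using p[of 7] K(1) n0 by (intro mult_right_mono) auto
        finally show ?thesis .
      qed
      have "bessel_Phi d s + a1 * (n * r\<^sup>2) + 4 * a2 * (r\<^sup>2 * s)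
          + (\<bar>a2\<bar> + 128 * L * s\<^sup>2) * (3 * n\<^sup>2 * (r\<^sup>2)\<^sup>2) + 840 * L * n ^ 4 * (r\<^sup>2) ^ 4
        \<le> bessel_Phi d s - r\<^sup>2 * (bessel_Phi d s / 2) + r ^ 3 * C"
        unfolding main C_def distrib_right[of "\<bar>a2\<bar>"] using e1 e2 e3 e4 by (simp only: distrib_left)
      also have "r ^ 3 * C \<le> r\<^sup>2 * ((1 / 2 - \<gamma>) * bessel_Phi d s)"
      proof -
        have "C * r \<le> (1 / 2 - \<gamma>) * bessel_Phi d s"
          using Cr s0(2)[of s] s \<gamma> unfolding m_def
          by (meson atLeastAtMost_iff diff_ge_0_iff_ge less_imp_le mult_left_mono order_trans)
        then have "r\<^sup>2 * (C * r) \<le> r\<^sup>2 * ((1 / 2 - \<gamma>) * bessel_Phi d s)" by (intro mult_left_mono) auto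
        then show ?thesis by (simp add: power3_eq_cube power2_eq_square ac_simps)
      qed
      also have "bessel_Phi d s - r\<^sup>2 * (bessel_Phi d s / 2) + r\<^sup>2 * ((1 / 2 - \<gamma>) * bessel_Phi d s)
         = (1 + - \<gamma> * r\<^sup>2) * bessel_Phi d s" by (simp add: algebra_simps)
      also have "\<dots> \<le> exp (- \<gamma> * r\<^sup>2) * bessel_Phi d s"
        using s \<rho> pos[of s] by (intro mult_right_mono exp_ge_add_one_self) auto
      finally show "bessel_Phi d s + a1 * (n * r\<^sup>2) + 4 * a2 * (r\<^sup>2 * s)
          + (\<bar>a2\<bar> + 128 * L * s\<^sup>2) * (3 * n\<^sup>2 * (r\<^sup>2)\<^sup>2) + 840 * L * n ^ 4 * (r\<^sup>2) ^ 4
        \<le> exp (- \<gamma> * r\<^sup>2) * bessel_Phi d s" by simp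
    qed
    also have "\<dots> = ennreal (exp (- \<gamma> * r\<^sup>2)) * ennreal (w \<kappa> x)"
      using x by (subst ennreal_mult'[symmetric]) (simp_all add: w_def s_def)
    finally show "(\<integral>\<^sup>+h. ennreal (w \<kappa> (x + h)) \<partial>gaussian (r\<^sup>2 / \<kappa>\<^sup>2))
       \<le> ennreal (exp (- \<gamma> * r\<^sup>2)) * ennreal (w \<kappa> x)" .
  qed
qed

text \<open>\<open>j\<^sup>2 / 2\<close> is the principal Dirichlet eigenvalue of half the Laplacian on the unit ball.\<close>

lemma brownian_ball_survival:
  fixes B :: "'a::euclidean_space set"
  assumes X: "brownian_motion M X"
    and B: "B \<subseteq> Basis" "B \<noteq> {}" and d: "d = real (card B) / 2" and j: "j > 0"
    and pos: "\<And>s. 0 \<le> s \<Longrightarrow> s < j\<^sup>2 \<Longrightarrow> bessel_Phi d s > 0"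
    and \<gamma>: "0 \<le> \<gamma>" "\<gamma> < j\<^sup>2 / 2"
  obtains c C where "c > 0" "C > 0"
    "\<And>R x T. R > 0 \<Longrightarrow> T \<ge> 0 \<Longrightarrow>
      measure M {\<omega>\<in>space M. \<forall>k. real k * (c * R\<^sup>2) \<le> T \<longrightarrow> part_sq B (x + X (real k * (c * R\<^sup>2)) \<omega>) \<le> R\<^sup>2}
        \<le> C * exp (- \<gamma> * T / R\<^sup>2)"
proof -
  interpret prob_space M by (rule brownian_prob_space[OF X])
  have fin: "finite B" using B(1) by (rule finite_subset) simp
  then have d0: "d > 0" using B(2) by (simp add: d card_gt_0_iff)
  \<comment> \<open>Midpoint of \<open>2 * \<gamma>\<close> and \<open>j\<^sup>2\<close>: inside the
    first zero, yet with \<open>\<gamma> / \<rho>0 < 1 / 2\<close> as \<open>bessel_step\<close>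
    demands.\<close>
  define \<rho>0 where "\<rho>0 = \<gamma> + j\<^sup>2 / 2"
  have \<rho>00: "\<rho>0 > 0" "\<gamma> < \<rho>0 / 2" "\<rho>0 < j\<^sup>2" using \<gamma> j by (auto simp: \<rho>0_def add_nonneg_pos)
  define \<rho>1 where "\<rho>1 = (\<rho>0 + j\<^sup>2) / 2"
  have \<rho>: "0 < \<rho>0" "\<rho>0 < \<rho>1" "\<rho>1 < j\<^sup>2" using \<rho>00 by (auto simp: \<rho>1_def)
  have pos': "\<And>s. 0 \<le> s \<Longrightarrow> s \<le> \<rho>1 \<Longrightarrow> bessel_Phi d s > 0" using pos \<rho> by auto
  define g where "g = \<gamma> / \<rho>0"
  have g: "0 \<le> g" "g < 1 / 2" "g * \<rho>0 = \<gamma>" using \<rho>00 \<gamma> by (auto simp: g_def field_simps)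
  define w where "w \<kappa> y = (if \<kappa>\<^sup>2 * part_sq B y \<le> \<rho>0 then bessel_Phi d (\<kappa>\<^sup>2 * part_sq B y) else 0)" for \<kappa> y
  obtain \<delta> where \<delta>: "\<delta> > 0"
    "\<And>\<kappa> x. \<kappa> > 0 \<Longrightarrow> \<kappa>\<^sup>2 * part_sq B x \<le> \<rho>0 \<Longrightarrow>
      (\<integral>\<^sup>+h. ennreal (w \<kappa> (x + h)) \<partial>gaussian (\<delta> / \<kappa>\<^sup>2)) \<le> ennreal (exp (- g * \<delta>)) * ennreal (w \<kappa> x)"
    unfolding w_def using bessel_step[OF B d \<rho>(1,2) pos' g(2)] by blast
  have cont: "continuous_on {0..\<rho>0} (bessel_Phi d)" by (intro continuous_bessel_Phi d0)
  obtain s0 where s0: "s0 \<in> {0..\<rho>0}" "\<And>s. s \<in> {0..\<rho>0} \<Longrightarrow> bessel_Phi d s0 \<le> bessel_Phi d s"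
    using continuous_attains_inf[OF _ _ cont] \<rho>(1) by auto
  obtain s1 where s1: "s1 \<in> {0..\<rho>0}" "\<And>s. s \<in> {0..\<rho>0} \<Longrightarrow> bessel_Phi d s \<le> bessel_Phi d s1"
    using continuous_attains_sup[OF _ _ cont] \<rho>(1) by auto
  define m where "m = bessel_Phi d s0"
  define mm where "mm = bessel_Phi d s1"
  have m: "m > 0" "mm > 0" unfolding m_def mm_def using s0(1) s1(1) \<rho> by (auto intro!: pos')
  have w_le: "w \<kappa> y \<le> mm" for \<kappa> y
    unfolding w_def mm_def using s1(2)[of "\<kappa>\<^sup>2 * part_sq B y"] m by (auto simp: part_sq_nonneg mm_def)
  show thesis
  proof (rule that[of "\<delta> / \<rho>0" "mm / m * exp (g * \<delta>)"])
    show "\<delta> / \<rho>0 > 0" "mm / m * exp (g * \<delta>) > 0" using \<delta>(1) \<rho>(1) m by auto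
    fix R T :: real and x :: 'a assume R: "R > 0" and T: "T \<ge> 0"
    \<comment> \<open>Sends the squared radius \<open>R\<^sup>2\<close> to the level \<rho>0; the
      mesh becomes proportional to \<open>R\<^sup>2\<close>.\<close>
    define \<kappa> where "\<kappa> = sqrt \<rho>0 / R"
    have \<kappa>: "\<kappa> > 0" "\<kappa>\<^sup>2 = \<rho>0 / R\<^sup>2" using R \<rho>(1) by (auto simp: \<kappa>_def power_divide)
    define \<tau> where "\<tau> = \<delta> / \<rho>0 * R\<^sup>2"
    have \<tau>: "\<tau> > 0" "\<tau> = \<delta> / \<kappa>\<^sup>2" using R \<rho>(1) \<delta>(1) \<kappa> by (auto simp: \<tau>_def)
    define D where "D = {y. \<kappa>\<^sup>2 * part_sq B y \<le> \<rho>0}"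
    have D_iff: "y \<in> D \<longleftrightarrow> part_sq B y \<le> R\<^sup>2" for y
      unfolding D_def \<kappa>(2) using R \<rho>(1) by (simp add: field_simps)
    have Dm [measurable]: "D \<in> sets borel" unfolding D_def by measurable
    have [measurable]: "bessel_Phi d \<in> borel_measurable borel"
      by (intro borel_measurable_continuous_onI continuous_bessel_Phi d0)
    have wm: "(\<lambda>y. ennreal (w \<kappa> y)) \<in> borel_measurable borel" unfolding w_def by measurable
    define N where "N = nat \<lfloor>T / \<tau>\<rfloor>"
    have N: "real k * \<tau> \<le> T \<longleftrightarrow> k \<le> N" for k
      using \<tau>(1) T unfolding N_def by (simp add: pos_le_divide_eq[symmetric] le_nat_floor le_nat_iff le_floor_iff)
    \<comment> \<open>Rounding \<open>T\<close> down to the grid loses at most one step, whence the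
      factor \<open>exp (g * \<delta>)\<close> in the constant.\<close>
    have NT: "\<delta> * real N \<ge> \<rho>0 * T / R\<^sup>2 - \<delta>"
    proof -
      have "T / \<tau> \<le> real N + 1" unfolding N_def using T \<tau>(1) by simp
      then have "\<delta> * (T / \<tau>) \<le> \<delta> * (real N + 1)" using \<delta>(1) by (intro mult_left_mono) auto
      moreover have "\<delta> * (T / \<tau>) = \<rho>0 * T / R\<^sup>2" using \<delta>(1) \<rho>(1) R by (simp add: \<tau>_def)
      ultimately show ?thesis by (simp add: algebra_simps)
    qed
    have "ennreal m * emeasure M {\<omega>\<in>space M. \<forall>k\<le>N. x + X (real k * \<tau>) \<omega> \<in> D}
      \<le> ennreal (exp (- g * \<delta>)) ^ N * ennreal (w \<kappa> x)"
    proof (rule brownian_grid_survival[OF X \<tau>(1) Dm wm])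
      fix y assume y: "y \<in> D"
      show "(\<integral>\<^sup>+h. ennreal (w \<kappa> (y + h)) \<partial>gaussian \<tau>) \<le> ennreal (exp (- g * \<delta>)) * ennreal (w \<kappa> y)"
        unfolding \<tau>(2) using y by (intro \<delta>(2) \<kappa>) (simp add: D_def)
      show "ennreal m \<le> ennreal (w \<kappa> y)"
        using y s0(2)[of "\<kappa>\<^sup>2 * part_sq B y"] by (intro ennreal_leI) (auto simp: D_def w_def m_def part_sq_nonneg)
    qed
    \<comment> \<open>Replacing \<open>w \<kappa> x\<close> by its maximum makes the bound uniform
      in the starting point.\<close>
    also have "\<dots> \<le> ennreal (exp (- g * \<delta>)) ^ N * ennreal mm"
      by (intro mult_left_mono ennreal_leI w_le) auto
    also have "\<dots> = ennreal (exp (- g * \<delta>) ^ N * mm)"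
      using m by (simp add: ennreal_power ennreal_mult'')
    finally have "m * prob {\<omega>\<in>space M. \<forall>k\<le>N. x + X (real k * \<tau>) \<omega> \<in> D} \<le> exp (- g * \<delta>) ^ N * mm"
      using m by (simp add: emeasure_eq_measure ennreal_mult''[symmetric])
    also have "exp (- g * \<delta>) ^ N = exp (- (g * (\<delta> * real N)))"
      by (simp add: exp_of_nat_mult[symmetric] ac_simps)
    also have "\<dots> \<le> exp (g * \<delta>) * exp (- \<gamma> * T / R\<^sup>2)"
    proof -
      have "g * (\<rho>0 * T / R\<^sup>2 - \<delta>) \<le> g * (\<delta> * real N)" using g NT by (intro mult_left_mono) auto
      moreover have "g * (\<rho>0 * T / R\<^sup>2 - \<delta>) = \<gamma> * T / R\<^sup>2 - g * \<delta>"
        using g(3) by (simp add: right_diff_distrib mult.assoc[symmetric])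
      ultimately show ?thesis by (simp add: exp_add[symmetric])
    qed
    finally have "m * prob {\<omega>\<in>space M. \<forall>k\<le>N. x + X (real k * \<tau>) \<omega> \<in> D}
        \<le> exp (g * \<delta>) * exp (- \<gamma> * T / R\<^sup>2) * mm" using m by (simp add: mult_right_mono)
    then have "prob {\<omega>\<in>space M. \<forall>k\<le>N. x + X (real k * \<tau>) \<omega> \<in> D} \<le> mm / m * exp (g * \<delta>) * exp (- \<gamma> * T / R\<^sup>2)"
      using m by (simp add: field_simps)
    then show "measure M {\<omega>\<in>space M. \<forall>k. real k * (\<delta> / \<rho>0 * R\<^sup>2) \<le> T \<longrightarrow>
        part_sq B (x + X (real k * (\<delta> / \<rho>0 * R\<^sup>2)) \<omega>) \<le> R\<^sup>2} \<le> mm / m * exp (g * \<delta>) * exp (- \<gamma> * T / R\<^sup>2)"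
      unfolding \<tau>_def[symmetric] N D_iff .
  qed
qed

section \<open>Survival in an interval and in the domain\<close>

text \<open>Turns membership in a generated \<sigma>-algebra into measurability in a measure space
  where every \<open>X t\<close> with \<open>t \<ge> 0\<close> is measurable, a goal suited to the
  \<open>measurable\<close> method.\<close>

lemma process_eventsI:
  assumes "\<And>N. space N = space M \<Longrightarrow> (\<And>t. t \<ge> 0 \<Longrightarrow> X t \<in> borel_measurable N) \<Longrightarrow> {\<omega> \<in> space N. P \<omega>} \<in> sets N"
  shows "{\<omega> \<in> space M. P \<omega>} \<in> process_events M X"
proof -
  define G where "G = {X t -` A \<inter> space M | t A. 0 \<le> t \<and> A \<in> sets borel}"
  define N where "N = sigma (space M) G"
  have G: "G \<subseteq> Pow (space M)" unfolding G_def by auto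
  then have "space N = space M" and sets: "sets N = sigma_sets (space M) G"
    unfolding N_def by (simp_all add: space_measure_of sets_measure_of)
  moreover have "X t \<in> borel_measurable N" if "t \<ge> 0" for t
  proof (rule measurableI)
    fix A :: "'b set" assume "A \<in> sets borel"
    then have "X t -` A \<inter> space M \<in> G" using that unfolding G_def by blast
    then show "X t -` A \<inter> space N \<in> sets N" unfolding sets \<open>space N = space M\<close> by (rule sigma_sets.Basic)
  qed simp
  ultimately have "{\<omega> \<in> space N. P \<omega>} \<in> sets N" by (intro assms)
  then show ?thesis unfolding \<open>space N = space M\<close> sets unfolding process_events_def G_def .
qed

lemma process_events_subset:
  assumes "\<And>t. t \<ge> 0 \<Longrightarrow> X t \<in> borel_measurable M"
  shows "process_events M X \<subseteq> sets M"
  unfolding process_events_def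
  by (rule sets.sigma_sets_subset) (use assms in auto)

lemma brownian_coord_tail:
  fixes X :: "real \<Rightarrow> 'w \<Rightarrow> 'a::euclidean_space"
  assumes X: "brownian_motion M X" and t: "t \<ge> 0" and b: "b \<in> Basis"
  shows "measure M {\<omega>\<in>space M. a \<le> X t \<omega> \<bullet> b} \<le> exp (t / 2 - a)"
proof -
  interpret prob_space M by (rule brownian_prob_space[OF X])
  show ?thesis
  proof (cases "t = 0")
    case True
    have "{\<omega>\<in>space M. a \<le> X t \<omega> \<bullet> b} = (if a \<le> 0 then space M else {})"
      using brownian_0[OF X] True by auto
    then show ?thesis using True by (simp add: prob_space)
  next
    case False
    have [measurable]: "X t \<in> borel_measurable M" by (rule brownian_measurable[OF X t])
    have "distr M borel (\<lambda>\<omega>. X t \<omega> - X 0 \<omega>) = distr M borel (X t)"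
      using brownian_0[OF X] by (intro distr_cong) auto
    then have "distr M borel (X t) = gaussian t"
      using brownian_increment_distr[OF X, of 0 t] False t by simp
    moreover have "measure (distr M borel (X t)) {h. a \<le> h \<bullet> b} = measure M (X t -` {h. a \<le> h \<bullet> b} \<inter> space M)"
      by (intro measure_distr) measurable
    ultimately have "measure (gaussian t) {h. a \<le> h \<bullet> b} = measure M (X t -` {h. a \<le> h \<bullet> b} \<inter> space M)"
      by simp
    also have "X t -` {h. a \<le> h \<bullet> b} \<inter> space M = {\<omega>\<in>space M. a \<le> X t \<omega> \<bullet> b}" by auto
    finally show ?thesis using gaussian_upper_tail[of t b a] b False t by simp
  qed
qed

text \<open>An interval is a one-dimensional ball after a shift by \<open>(l1 - l2) / 2\<close>. The
  statement provides a larger event from the \<sigma>-algebra of \<open>Y\<close> because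
  independence will be applied to it.\<close>

lemma brownian_interval_survival:
  fixes Y :: "real \<Rightarrow> 'w \<Rightarrow> real"
  assumes Y: "brownian_motion M Y" and \<gamma>: "0 \<le> \<gamma>" "\<gamma> < pi\<^sup>2 / 2"
  obtains C where "C > 0"
    "\<And>l1 l2 T. l1 + l2 > 0 \<Longrightarrow> T \<ge> 0 \<Longrightarrow> \<exists>A\<in>process_events M Y.
       (\<forall>\<omega>\<in>space M. (\<forall>v\<in>{0..T}. - l1 \<le> Y v \<omega> \<and> Y v \<omega> \<le> l2) \<longrightarrow> \<omega> \<in> A) \<and>
       measure M A \<le> C * exp (- \<gamma> * T / (l1 + l2)\<^sup>2)"
proof -
  obtain c C where c: "c > 0" and C: "C > 0" and bd: "\<And>R x T. R > 0 \<Longrightarrow> T \<ge> 0 \<Longrightarrow>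
      measure M {\<omega>\<in>space M. \<forall>k. real k * (c * R\<^sup>2) \<le> T \<longrightarrow> part_sq {1} (x + Y (real k * (c * R\<^sup>2)) \<omega>) \<le> R\<^sup>2}
        \<le> C * exp (- (\<gamma> / 4) * T / R\<^sup>2)"
  \<comment> \<open>The radius is half the length of the interval, so \<open>\<gamma> / 4\<close>
    over the squared radius is \<gamma> over the squared length.\<close>
  proof (rule brownian_ball_survival[OF Y, of "{1}" "1/2" "pi / 2" "\<gamma> / 4"])
    show "\<gamma> / 4 < (pi / 2)\<^sup>2 / 2" using \<gamma> by (simp add: power_divide)
    fix s :: real assume "0 \<le> s" "s < (pi / 2)\<^sup>2"
    then show "bessel_Phi (1 / 2) s > 0" by (rule bessel_Phi_half_pos)
  qed (use \<gamma> in auto)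
  show thesis
  proof (rule that[OF C])
    fix l1 l2 T :: real assume l: "l1 + l2 > 0" and T: "T \<ge> 0"
    define R where "R = (l1 + l2) / 2"
    define x where "x = (l1 - l2) / 2"
    have R: "R > 0" using l by (simp add: R_def)
    define A where "A = {\<omega>\<in>space M. \<forall>k. real k * (c * R\<^sup>2) \<le> T \<longrightarrow> part_sq {1} (x + Y (real k * (c * R\<^sup>2)) \<omega>) \<le> R\<^sup>2}"
    have "A \<in> process_events M Y"
      unfolding A_def
    proof (rule process_eventsI)
      fix N assume N: "space N = space M" and "\<And>t. t \<ge> 0 \<Longrightarrow> Y t \<in> borel_measurable N"
      then have [measurable]: "Y (real k * (c * R\<^sup>2)) \<in> borel_measurable N" for k using c by auto
      show "{\<omega> \<in> space N. \<forall>k. real k * (c * R\<^sup>2) \<le> T \<longrightarrow> part_sq {1} (x + Y (real k * (c * R\<^sup>2)) \<omega>) \<le> R\<^sup>2} \<in> sets N"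
        by measurable
    qed
    moreover have "\<omega> \<in> A" if \<omega>: "\<omega> \<in> space M" "\<forall>v\<in>{0..T}. - l1 \<le> Y v \<omega> \<and> Y v \<omega> \<le> l2" for \<omega>
    proof -
      have "part_sq {1} (x + Y v \<omega>) \<le> R\<^sup>2" if "v \<in> {0..T}" for v
      proof -
        have "\<bar>x + Y v \<omega>\<bar> \<le> R" using bspec[OF \<omega>(2) that] unfolding x_def R_def by (simp add: abs_le_iff field_simps)
        then have "\<bar>x + Y v \<omega>\<bar>\<^sup>2 \<le> R\<^sup>2" by (intro power_mono) auto
        then show ?thesis by (simp add: part_sq_def)
      qed
      then show ?thesis using \<omega>(1) c R unfolding A_def by auto
    qed
    moreover have "measure M A \<le> C * exp (- \<gamma> * T / (l1 + l2)\<^sup>2)"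
      using bd[OF R T, of x] unfolding A_def by (simp add: R_def power_divide)
    ultimately show "\<exists>A\<in>process_events M Y.
       (\<forall>\<omega>\<in>space M. (\<forall>v\<in>{0..T}. - l1 \<le> Y v \<omega> \<and> Y v \<omega> \<le> l2) \<longrightarrow> \<omega> \<in> A) \<and>
       measure M A \<le> C * exp (- \<gamma> * T / (l1 + l2)\<^sup>2)" by blast
  qed
qed

text \<open>If at a grid time the path is in the domain and below height
  \<open>2 * S + snd z\<close>, then \<open>exp (norm x powr p)\<close> is below that height too, so
  the horizontal part has norm at most \<open>ln (2 * S + snd z) powr (1 / p)\<close>. The first
  term is the cost of this confinement, the second a union bound over the grid times for exceeding
  the height.\<close>

lemma brownian_domain_survival:
  fixes X :: "real \<Rightarrow> 'w \<Rightarrow> (real ^ 'n) \<times> real"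
  assumes X: "brownian_motion M X" and p: "p > 0"
    and \<gamma>: "0 \<le> \<gamma>" "\<gamma> < (bessel_zero ((real CARD('n) - 2) / 2))\<^sup>2 / 2"
  obtains c C where "c > 0" "C > 0"
    "\<And>S. S > 0 \<Longrightarrow> 2 * S + snd z > 1 \<Longrightarrow> \<exists>A\<in>process_events M X.
       (\<forall>\<omega>\<in>space M. (\<forall>v\<in>{0..S}. z + X v \<omega> \<in> above_graph (\<lambda>x. exp (norm x powr p))) \<longrightarrow> \<omega> \<in> A) \<and>
       measure M A \<le> C * exp (- \<gamma> * S / (ln (2 * S + snd z)) powr (2 / p))
         + (S / (c * ln (2 * S + snd z) powr (2 / p)) + 1) * exp (- (3 * S / 2))"
proof -
  interpret prob_space M by (rule brownian_prob_space[OF X])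
  define B :: "((real ^ 'n) \<times> real) set" where "B = (\<lambda>b. (b, 0)) ` Basis"
  have inj: "inj_on (\<lambda>b. (b, 0 :: real)) (Basis :: (real ^ 'n) set)" by (auto simp: inj_on_def)
  have B: "B \<subseteq> Basis" "B \<noteq> {}" by (auto simp: B_def Basis_prod_def)
  have card: "card B = CARD('n)" unfolding B_def by (simp add: card_image[OF inj])
  define d where "d = real (card B) / 2"
  have d: "d > 0" "d - 1 = (real CARD('n) - 2) / 2" by (auto simp: d_def card diff_divide_distrib)
  define j where "j = bessel_zero ((real CARD('n) - 2) / 2)"
  have j: "j > 0" "\<And>s. 0 \<le> s \<Longrightarrow> s < j\<^sup>2 \<Longrightarrow> bessel_Phi d s > 0"
    using bessel_zero_first[OF d(1)] unfolding j_def d(2) by auto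
  have part: "part_sq B y = (norm (fst y))\<^sup>2" for y
  proof -
    have "part_sq B y = (\<Sum>b\<in>Basis. (fst y \<bullet> b)\<^sup>2)"
      unfolding part_sq_def B_def by (simp add: sum.reindex[OF inj] inner_prod_def)
    also have "\<dots> = fst y \<bullet> fst y" using euclidean_inner[of "fst y" "fst y"] by (simp only: power2_eq_square)
    finally show ?thesis by (simp add: power2_norm_eq_inner)
  qed
  obtain c C where c: "c > 0" and C: "C > 0" and bd: "\<And>R x T. R > 0 \<Longrightarrow> T \<ge> 0 \<Longrightarrow>
      measure M {\<omega>\<in>space M. \<forall>k. real k * (c * R\<^sup>2) \<le> T \<longrightarrow> part_sq B (x + X (real k * (c * R\<^sup>2)) \<omega>) \<le> R\<^sup>2}
        \<le> C * exp (- \<gamma> * T / R\<^sup>2)"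
    using brownian_ball_survival[OF X B d_def j \<gamma>(1) \<gamma>(2)[folded j_def]] by blast
  show thesis
  proof (rule that[OF c C])
    fix S :: real assume S: "S > 0" and Sz: "2 * S + snd z > 1"
    define R where "R = ln (2 * S + snd z) powr (1 / p)"
    have lnp: "ln (2 * S + snd z) > 0" using Sz by simp
    then have R: "R > 0" by (simp add: R_def)
    have R2: "R\<^sup>2 = ln (2 * S + snd z) powr (2 / p)"
      using lnp by (simp add: R_def powr_powr[symmetric] powr_realpow[symmetric] powr_powr)
    define \<tau> where "\<tau> = c * R\<^sup>2"
    have \<tau>: "\<tau> > 0" using c R by (simp add: \<tau>_def)
    define N where "N = nat \<lfloor>S / \<tau>\<rfloor>"
    have N: "real k * \<tau> \<le> S \<longleftrightarrow> k \<le> N" for k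
      using \<tau>(1) S unfolding N_def by (simp add: pos_le_divide_eq[symmetric] le_nat_floor le_nat_iff le_floor_iff)
    define A1 where "A1 = {\<omega>\<in>space M. \<forall>k. real k * \<tau> \<le> S \<longrightarrow> part_sq B (z + X (real k * \<tau>) \<omega>) \<le> R\<^sup>2}"
    define E where "E k = {\<omega>\<in>space M. 2 * S \<le> X (real k * \<tau>) \<omega> \<bullet> (0, 1)}" for k
    \<comment> \<open>A single comprehension, as \<open>process_eventsI\<close> expects; the union
      \<open>AU\<close> serves the estimate.\<close>
    define A where "A = {\<omega>\<in>space M. (\<forall>k. real k * \<tau> \<le> S \<longrightarrow> part_sq B (z + X (real k * \<tau>) \<omega>) \<le> R\<^sup>2)
       \<or> (\<exists>k\<in>{..N}. 2 * S \<le> X (real k * \<tau>) \<omega> \<bullet> (0, 1))}"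
    have AU: "A = A1 \<union> (\<Union>k\<in>{..N}. E k)" unfolding A_def A1_def E_def by auto
    have [measurable]: "X (real k * \<tau>) \<in> borel_measurable M" for k
      using \<tau> by (intro brownian_measurable[OF X]) auto
    have meas [measurable]: "A1 \<in> events" "E k \<in> events" for k unfolding A1_def E_def by measurable
    have "A \<in> process_events M X"
      unfolding A_def
    proof (rule process_eventsI)
      fix L assume L: "space L = space M" and "\<And>t. t \<ge> 0 \<Longrightarrow> X t \<in> borel_measurable L"
      then have [measurable]: "X (real k * \<tau>) \<in> borel_measurable L" for k using \<tau> by auto
      show "{\<omega>\<in>space L. (\<forall>k. real k * \<tau> \<le> S \<longrightarrow> part_sq B (z + X (real k * \<tau>) \<omega>) \<le> R\<^sup>2)
       \<or> (\<exists>k\<in>{..N}. 2 * S \<le> X (real k * \<tau>) \<omega> \<bullet> (0, 1))} \<in> sets L"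
        by measurable
    qed
    moreover have "\<omega> \<in> A" if \<omega>: "\<omega> \<in> space M"
      "\<forall>v\<in>{0..S}. z + X v \<omega> \<in> above_graph (\<lambda>x. exp (norm x powr p))" for \<omega>
    proof (rule ccontr)
      assume nA: "\<omega> \<notin> A"
      then obtain k where k: "k \<le> N" "\<not> part_sq B (z + X (real k * \<tau>) \<omega>) \<le> R\<^sup>2"
        using \<omega>(1) unfolding A_def N by blast
      have k3: "X (real k * \<tau>) \<omega> \<bullet> (0, 1) < 2 * S"
        using nA \<omega>(1) k(1) unfolding A_def by (auto simp: not_le)
      define y where "y = z + X (real k * \<tau>) \<omega>"
      have "y \<in> above_graph (\<lambda>x. exp (norm x powr p))"
        using \<omega>(2) k(1) N[of k] \<tau> unfolding y_def by auto
      then have "exp (norm (fst y) powr p) < snd y" by (auto simp: above_graph_def case_prod_beta)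
      also have "snd y < 2 * S + snd z" using k3 by (simp add: y_def inner_prod_def)
      finally have "exp (norm (fst y) powr p) < exp (ln (2 * S + snd z))" using Sz by simp
      then have "norm (fst y) powr p < ln (2 * S + snd z)" by (simp only: exp_less_cancel_iff)
      then have "(norm (fst y) powr p) powr (1 / p) \<le> R" unfolding R_def using p by (intro powr_mono2) auto
      then have "norm (fst y) \<le> R" using p by (simp add: powr_powr)
      then have "part_sq B y \<le> R\<^sup>2" unfolding part by (intro power_mono) auto
      then show False using k(2) by (simp add: y_def)
    qed
    moreover have "measure M A \<le> C * exp (- \<gamma> * S / (ln (2 * S + snd z)) powr (2 / p))
         + (S / (c * ln (2 * S + snd z) powr (2 / p)) + 1) * exp (- (3 * S / 2))"
    proof -
      have "prob A \<le> prob A1 + prob (\<Union>k\<in>{..N}. E k)" unfolding AU by (intro measure_subadditive) auto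
      also have "prob (\<Union>k\<in>{..N}. E k) \<le> (\<Sum>k\<in>{..N}. prob (E k))"
        by (intro finite_measure_subadditive_finite) auto
      also have "\<dots> \<le> (\<Sum>k\<in>{..N}. exp (- (3 * S / 2)))"
      proof (rule sum_mono)
        fix k assume "k \<in> {..N}"
        then have "real k * \<tau> \<le> S" by (simp add: N)
        \<comment> \<open>A grid time is at most \<open>S\<close>, so the exponent is at most
          \<open>S / 2 - 2 * S\<close>.\<close>
        moreover have "prob (E k) \<le> exp (real k * \<tau> / 2 - 2 * S)"
          unfolding E_def using \<tau> by (intro brownian_coord_tail[OF X]) (auto simp: Basis_prod_def)
        ultimately show "prob (E k) \<le> exp (- (3 * S / 2))"
          by (elim order_trans) (simp add: mult.commute)
      qed
      also have "\<dots> = (real N + 1) * exp (- (3 * S / 2))" by simp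
      also have "\<dots> \<le> (S / \<tau> + 1) * exp (- (3 * S / 2))"
        unfolding N_def using S \<tau> by (intro mult_right_mono add_right_mono) (auto simp: of_nat_nat)
      also have "prob A1 \<le> C * exp (- \<gamma> * S / R\<^sup>2)"
        using bd[OF R, of S z] S unfolding A1_def \<tau>_def by simp
      finally show ?thesis unfolding \<tau>_def R2 by simp
    qed
    ultimately show "\<exists>A\<in>process_events M X.
       (\<forall>\<omega>\<in>space M. (\<forall>v\<in>{0..S}. z + X v \<omega> \<in> above_graph (\<lambda>x. exp (norm x powr p))) \<longrightarrow> \<omega> \<in> A) \<and>
       measure M A \<le> C * exp (- \<gamma> * S / (ln (2 * S + snd z)) powr (2 / p))
         + (S / (c * ln (2 * S + snd z) powr (2 / p)) + 1) * exp (- (3 * S / 2))" by blast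
  qed
qed

section \<open>Asymptotics\<close>

text \<open>The solution \<open>W\<close> of \<open>W ^ 3 = t * ln t powr (2 / p)\<close>: at this
  length the confinement cost \<open>W / ln t powr (2 / p)\<close> and the range cost
  \<open>t / W\<^sup>2\<close> coincide, and their common value is
  \<open>decay_rate\<close>.\<close>

definition space_scale :: "real \<Rightarrow> real \<Rightarrow> real" where
  "space_scale p t = t powr (1 / 3) * ln t powr (2 / (3 * p))"

definition decay_rate :: "real \<Rightarrow> real \<Rightarrow> real" where
  "decay_rate p t = t powr (1 / 3) * ln t powr (- (4 / (3 * p)))"

lemma scale_relations:
  assumes "t > 1" "p > 0"
  shows "decay_rate p t > 0" "space_scale p t > 0"
    and "space_scale p t = decay_rate p t * ln t powr (2 / p)"
    and "t / (space_scale p t)\<^sup>2 = decay_rate p t"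
    and "t powr (- 1 / 3) * ln t powr (4 / (3 * p)) = 1 / decay_rate p t"
proof -
  have ln: "ln t > 0" using assms by simp
  show "decay_rate p t > 0" "space_scale p t > 0"
    using ln assms by (auto simp: decay_rate_def space_scale_def)
  have "2 / (3 * p) = - (4 / (3 * p)) + 2 / p" using assms by (simp add: field_simps)
  then show "space_scale p t = decay_rate p t * ln t powr (2 / p)"
    unfolding space_scale_def decay_rate_def by (simp only: powr_add mult.assoc)
  have "(space_scale p t)\<^sup>2 = t powr (2 / 3) * ln t powr (4 / (3 * p))"
    unfolding space_scale_def power2_eq_square by (simp add: ac_simps flip: powr_add)
  moreover have "t powr (1 / 3) * t powr (2 / 3) = t" using assms by (simp flip: powr_add)
  ultimately show "t / (space_scale p t)\<^sup>2 = decay_rate p t"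
    unfolding decay_rate_def using ln assms by (simp add: powr_minus field_simps)
  show "t powr (- 1 / 3) * ln t powr (4 / (3 * p)) = 1 / decay_rate p t"
    unfolding decay_rate_def using ln assms by (simp add: powr_minus field_simps)
qed

lemma decay_rate_at_top: "p > 0 \<Longrightarrow> filterlim (decay_rate p) at_top at_top"
  unfolding decay_rate_def[abs_def] by (cases "4 / (3 * p) > 0") (real_asymp, simp)

lemma space_scale_at_top: "p > 0 \<Longrightarrow> filterlim (space_scale p) at_top at_top"
  unfolding space_scale_def[abs_def] by (cases "2 / (3 * p) > 0") (real_asymp, simp)

text \<open>Source of the factor \<open>3 powr (2 / p)\<close>: the paths \<open>Xp\<close> and
  \<open>Xm\<close> run for a time of order \<open>t powr (1 / 3)\<close> up to logarithms, whose
  logarithm is a third of \<open>ln t\<close>. Neither \<open>a\<close> nor the starting height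
  influences the limit.\<close>

lemma ln_space_scale_ratio:
  assumes "a > 0" "p > 0"
  shows "((\<lambda>t. ln (2 * (a * space_scale p t) + z) / ln t) \<longlongrightarrow> 1 / 3) at_top"
proof -
  have "2 / (3 * p) > 0" using assms by simp
  with \<open>a > 0\<close> show ?thesis unfolding space_scale_def by real_asymp
qed

text \<open>Prefactors are paid for by an arbitrarily small loss in the rate.\<close>

lemma eventually_exp_absorb:
  fixes \<psi> :: "real \<Rightarrow> real"
  assumes \<psi>: "filterlim \<psi> at_top F" and k: "k' < k" and C: "C > 0"
  shows "eventually (\<lambda>t. C * exp (- k * \<psi> t) \<le> exp (- k' * \<psi> t)) F"
proof -
  have "eventually (\<lambda>t. \<psi> t \<ge> ln C / (k - k')) F"
    using \<psi> by (simp add: filterlim_at_top)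
  then show ?thesis
  proof eventually_elim
    case (elim t)
    then have "ln C \<le> (k - k') * \<psi> t" using k by (simp add: field_simps)
    then have "ln C + - k * \<psi> t \<le> - k' * \<psi> t" by (simp add: algebra_simps)
    then have "exp (ln C + - k * \<psi> t) \<le> exp (- k' * \<psi> t)" by (simp only: exp_le_cancel_iff)
    then show ?case using C by (simp only: exp_add exp_ln)
  qed
qed

section \<open>Survival estimates on the common scale\<close>

lemma brownian_interval_survival_scaled:
  fixes Y :: "real \<Rightarrow> 'w \<Rightarrow> real"
  assumes Y: "brownian_motion M Y" and \<gamma>: "0 \<le> \<gamma>" "\<gamma> < pi\<^sup>2 / 2" and p: "p > 0" and l: "l1 + l2 > 0"
  shows "eventually (\<lambda>t. \<exists>A\<in>process_events M Y.
      (\<forall>\<omega>\<in>space M. (\<forall>v\<in>{0..t}. - (l1 * space_scale p t) \<le> Y v \<omega> \<and> Y v \<omega> \<le> l2 * space_scale p t) \<longrightarrow> \<omega> \<in> A) \<and>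
      measure M A \<le> exp (- (\<gamma> / (l1 + l2)\<^sup>2) * decay_rate p t)) at_top"
proof -
  obtain \<gamma>' where \<gamma>': "\<gamma> < \<gamma>'" "\<gamma>' < pi\<^sup>2 / 2" using dense[OF \<gamma>(2)] by blast
  then have "0 \<le> \<gamma>'" using \<gamma> by simp
  then obtain C where C: "C > 0"
    "\<And>l1 l2 T. l1 + l2 > 0 \<Longrightarrow> T \<ge> 0 \<Longrightarrow> \<exists>A\<in>process_events M Y.
       (\<forall>\<omega>\<in>space M. (\<forall>v\<in>{0..T}. - l1 \<le> Y v \<omega> \<and> Y v \<omega> \<le> l2) \<longrightarrow> \<omega> \<in> A) \<and>
       measure M A \<le> C * exp (- \<gamma>' * T / (l1 + l2)\<^sup>2)"
    using brownian_interval_survival[OF Y _ \<gamma>'(2)] by metis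
  have "\<gamma> / (l1 + l2)\<^sup>2 < \<gamma>' / (l1 + l2)\<^sup>2" using \<gamma>' l by (intro divide_strict_right_mono) auto
  from eventually_exp_absorb[OF decay_rate_at_top[OF p] this C(1)] eventually_gt_at_top[of 1]
  show ?thesis
  proof eventually_elim
    case (elim t)
    note sc = scale_relations[OF elim(2) p]
    have "l1 * space_scale p t + l2 * space_scale p t > 0"
      using l sc(2) by (simp flip: distrib_right)
    from C(2)[OF this, of t] elim(2) obtain A where A: "A \<in> process_events M Y"
      "\<forall>\<omega>\<in>space M. (\<forall>v\<in>{0..t}. - (l1 * space_scale p t) \<le> Y v \<omega> \<and> Y v \<omega> \<le> l2 * space_scale p t) \<longrightarrow> \<omega> \<in> A"
      "measure M A \<le> C * exp (- \<gamma>' * t / (l1 * space_scale p t + l2 * space_scale p t)\<^sup>2)" by auto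
    have "- \<gamma>' * t / (l1 * space_scale p t + l2 * space_scale p t)\<^sup>2
        = - (\<gamma>' / (l1 + l2)\<^sup>2) * (t / (space_scale p t)\<^sup>2)"
      by (simp add: power_mult_distrib flip: distrib_right)
    then have "measure M A \<le> exp (- (\<gamma> / (l1 + l2)\<^sup>2) * decay_rate p t)"
      using A(3) elim(1) unfolding sc(4) by simp
    then show ?case using A(1,2) by blast
  qed
qed

text \<open>The duration is \<open>a * decay_rate p t * ln t powr (2 / p)\<close> and the logarithm
  in the denominator is about \<open>ln t / 3\<close>; the powers of \<open>ln t\<close> cancel and
  leave \<open>3 powr (2 / p) * a\<close>.\<close>

lemma brownian_domain_survival_scaled:
  fixes X :: "real \<Rightarrow> 'w \<Rightarrow> (real ^ 'n) \<times> real"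
  assumes X: "brownian_motion M X" and p: "p > 0"
    and \<gamma>: "0 \<le> \<gamma>" "\<gamma> < (bessel_zero ((real CARD('n) - 2) / 2))\<^sup>2 / 2" and a: "a > 0"
  shows "eventually (\<lambda>t. \<exists>A\<in>process_events M X.
      (\<forall>\<omega>\<in>space M. (\<forall>v\<in>{0..a * space_scale p t}. z + X v \<omega> \<in> above_graph (\<lambda>x. exp (norm x powr p))) \<longrightarrow> \<omega> \<in> A) \<and>
      measure M A \<le> exp (- (\<gamma> * 3 powr (2 / p) * a) * decay_rate p t)) at_top"
proof -
  obtain \<gamma>' where \<gamma>': "\<gamma> < \<gamma>'" "\<gamma>' < (bessel_zero ((real CARD('n) - 2) / 2))\<^sup>2 / 2" using dense[OF \<gamma>(2)] by blast
  \<comment> \<open>Two gaps: from \<gamma>' to \<gamma>2 for the limit of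
    \<open>ln t / L t\<close>, and from \<gamma>2 to \<gamma> for the constant \<open>2 * C\<close>,
    whose factor 2 leaves half of the target to the height term.\<close>
  obtain \<gamma>2 where \<gamma>2: "\<gamma> < \<gamma>2" "\<gamma>2 < \<gamma>'" using dense[OF \<gamma>'(1)] by blast
  have \<gamma>'0: "0 \<le> \<gamma>'" "0 < \<gamma>'" using \<gamma> \<gamma>' by auto
  define S where "S t = a * space_scale p t" for t
  define L where "L t = ln (2 * S t + snd z)" for t
  obtain c C where c: "c > 0" and C: "C > 0" and bd:
    "\<And>S. S > 0 \<Longrightarrow> 2 * S + snd z > 1 \<Longrightarrow> \<exists>A\<in>process_events M X.
       (\<forall>\<omega>\<in>space M. (\<forall>v\<in>{0..S}. z + X v \<omega> \<in> above_graph (\<lambda>x. exp (norm x powr p))) \<longrightarrow> \<omega> \<in> A) \<and>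
       measure M A \<le> C * exp (- \<gamma>' * S / (ln (2 * S + snd z)) powr (2 / p))
         + (S / (c * ln (2 * S + snd z) powr (2 / p)) + 1) * exp (- (3 * S / 2))"
    using brownian_domain_survival[OF X p \<gamma>'0(1) \<gamma>'(2), of z] by metis
  have S_top: "filterlim S at_top at_top"
    unfolding S_def[abs_def] using a by (intro filterlim_tendsto_pos_mult_at_top[OF tendsto_const] space_scale_at_top p)
  have e1: "eventually (\<lambda>t. S t \<ge> max 1 (exp 1 - snd z)) at_top"
    using S_top unfolding filterlim_at_top by blast
  have "eventually (\<lambda>s::real. s / c + 1 \<le> exp (s / 2)) at_top" using c by real_asymp
  then have e2: "eventually (\<lambda>t. S t / c + 1 \<le> exp (S t / 2)) at_top"
    using S_top by (rule eventually_compose_filterlim)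
  have e3: "eventually (\<lambda>t. \<gamma>2 * 3 powr (2 / p) < \<gamma>' * (ln t / L t) powr (2 / p)) at_top"
  proof -
    have "((\<lambda>t. inverse (L t / ln t)) \<longlongrightarrow> inverse (1 / 3)) at_top"
      unfolding L_def S_def by (intro tendsto_inverse ln_space_scale_ratio a p) simp
    then have "((\<lambda>t. ln t / L t) \<longlongrightarrow> 3) at_top" by simp
    then have "((\<lambda>t. \<gamma>' * (ln t / L t) powr (2 / p)) \<longlongrightarrow> \<gamma>' * 3 powr (2 / p)) at_top"
      by (intro tendsto_intros) auto
    moreover have "\<gamma>2 * 3 powr (2 / p) < \<gamma>' * 3 powr (2 / p)" using \<gamma>2 by simp
    ultimately show ?thesis by (rule order_tendstoD)
  qed
  have "\<gamma> * 3 powr (2 / p) * a < \<gamma>2 * 3 powr (2 / p) * a" using \<gamma>2 a by simp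
  then have e4: "eventually (\<lambda>t. 2 * C * exp (- (\<gamma>2 * 3 powr (2 / p) * a) * decay_rate p t)
      \<le> exp (- (\<gamma> * 3 powr (2 / p) * a) * decay_rate p t)) at_top"
    using C by (intro eventually_exp_absorb decay_rate_at_top p) auto
  have "2 / p > 0" using p by simp
  then have "filterlim (\<lambda>t::real. ln t powr (2 / p)) at_top at_top" by real_asymp
  then have e5: "eventually (\<lambda>t. ln t powr (2 / p) \<ge> \<gamma> * 3 powr (2 / p) + 1) at_top"
    by (simp add: filterlim_at_top)
  have e6: "eventually (\<lambda>t. decay_rate p t \<ge> ln 2 / a) at_top"
    using decay_rate_at_top[OF p] by (simp add: filterlim_at_top)
  from e1 e2 e3 e4 e5 e6 eventually_gt_at_top[of 1] show ?thesis
  proof eventually_elim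
    case (elim t)
    note sc = scale_relations[OF elim(7) p]
    have S1: "S t \<ge> 1" "2 * S t + snd z > exp 1" using elim(1) by auto
    have L1: "L t > 1" unfolding L_def
      using S1(2) by (metis exp_gt_zero ln_exp ln_less_cancel_iff order_less_trans)
    have "2 * S t + snd z > 1" using S1(2) by (meson exp_gt_one less_trans zero_less_one)
    from bd[OF _ this] S1(1) obtain A where A: "A \<in> process_events M X"
      "\<forall>\<omega>\<in>space M. (\<forall>v\<in>{0..S t}. z + X v \<omega> \<in> above_graph (\<lambda>x. exp (norm x powr p))) \<longrightarrow> \<omega> \<in> A"
      "measure M A \<le> C * exp (- \<gamma>' * S t / L t powr (2 / p)) + (S t / (c * L t powr (2 / p)) + 1) * exp (- (3 * S t / 2))"
      unfolding L_def by auto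
    define h where "h = \<gamma> * 3 powr (2 / p) * a * decay_rate p t"
    have ad: "a * decay_rate p t > 0" using a sc(1) by simp
    have "C * exp (- \<gamma>' * S t / L t powr (2 / p)) \<le> exp (- h) / 2"
    proof -
      have "\<gamma>' * S t / L t powr (2 / p) = \<gamma>' * (ln t / L t) powr (2 / p) * (a * decay_rate p t)"
        using L1 elim(7) unfolding S_def sc(3) by (simp add: powr_divide)
      also have "\<dots> \<ge> \<gamma>2 * 3 powr (2 / p) * (a * decay_rate p t)"
        using elim(3) ad by (intro mult_right_mono) auto
      finally have "exp (- \<gamma>' * S t / L t powr (2 / p)) \<le> exp (- (\<gamma>2 * 3 powr (2 / p) * a) * decay_rate p t)"
        by (simp add: mult.assoc)
      then have "2 * C * exp (- \<gamma>' * S t / L t powr (2 / p)) \<le> 2 * C * exp (- (\<gamma>2 * 3 powr (2 / p) * a) * decay_rate p t)"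
        using C by (intro mult_left_mono) auto
      also note elim(4)
      finally show ?thesis unfolding h_def by simp
    qed
    moreover have "(S t / (c * L t powr (2 / p)) + 1) * exp (- (3 * S t / 2)) \<le> exp (- h) / 2"
    proof -
      have "L t powr (2 / p) \<ge> 1" using L1 p by (simp add: ge_one_powr_ge_zero)
      then have "c * 1 \<le> c * L t powr (2 / p)" using c by (intro mult_left_mono) auto
      then have "S t / (c * L t powr (2 / p)) \<le> S t / c"
        using c S1(1) \<open>L t powr (2 / p) \<ge> 1\<close> by (intro frac_le) auto
      then have "S t / (c * L t powr (2 / p)) + 1 \<le> exp (S t / 2)" using elim(2) by simp
      then have "(S t / (c * L t powr (2 / p)) + 1) * exp (- (3 * S t / 2)) \<le> exp (S t / 2) * exp (- (3 * S t / 2))"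
        by (intro mult_right_mono) auto
      also have "\<dots> = exp (- S t)" by (simp flip: exp_add)
      \<comment> \<open>\<open>S t\<close> exceeds \<open>h\<close> by the diverging factor
        \<open>ln t powr (2 / p)\<close>; the summand 1 in \<open>e5\<close> yields an extra
        \<open>a * decay_rate p t\<close>, which covers \<open>ln 2\<close>.\<close>
      also have "\<dots> \<le> exp (- h - ln 2)"
      proof -
        have "(\<gamma> * 3 powr (2 / p) + 1) * (a * decay_rate p t) \<le> ln t powr (2 / p) * (a * decay_rate p t)"
          using elim(5) ad by (intro mult_right_mono) auto
        then have "h + a * decay_rate p t \<le> S t" unfolding h_def S_def sc(3) by (simp add: algebra_simps)
        moreover have "ln 2 \<le> a * decay_rate p t" using elim(6) a by (simp add: field_simps)
        ultimately show ?thesis by simp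
      qed
      also have "\<dots> = exp (- h) / 2" by (simp add: exp_diff)
      finally show ?thesis .
    qed
    ultimately have "measure M A \<le> exp (- h)" using A(3) by linarith
    then show ?case using A(1,2) unfolding h_def S_def by (intro bexI[of _ A]) auto
  qed
qed

section \<open>From the iterated motion to three independent paths\<close>

lemma iterated_survival_range:
  assumes t: "t \<ge> 0" and exit: "ereal t < exit_time D (iterated_process z Xp Xm Y) \<omega>"
    and cont: "continuous_on {0..} (\<lambda>s. Y s \<omega>)" and Y0: "Y 0 \<omega> = 0" and X0: "Xp 0 \<omega> = 0" "Xm 0 \<omega> = 0"
  obtains a b :: real where "a \<ge> 0" "b \<ge> 0" "\<forall>s\<in>{0..t}. - a \<le> Y s \<omega> \<and> Y s \<omega> \<le> b"
    "\<forall>v\<in>{0..b}. z + Xp v \<omega> \<in> D" "\<forall>v\<in>{0..a}. z + Xm v \<omega> \<in> D"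
proof -
  have inD: "iterated_process z Xp Xm Y s \<omega> \<in> D" if "s \<in> {0..t}" for s
  proof (rule ccontr)
    assume "\<not> ?thesis"
    then have "exit_time D (iterated_process z Xp Xm Y) \<omega> \<le> ereal s"
      unfolding exit_time_def using that by (intro Inf_lower) auto
    also have "\<dots> \<le> ereal t" using that by simp
    finally show False using exit by simp
  qed
  have ct: "continuous_on {0..t} (\<lambda>s. Y s \<omega>)" using cont by (rule continuous_on_subset) auto
  obtain s1 where s1: "s1 \<in> {0..t}" "\<And>s. s \<in> {0..t} \<Longrightarrow> Y s \<omega> \<le> Y s1 \<omega>"
    using continuous_attains_sup[OF _ _ ct] t by auto
  obtain s2 where s2: "s2 \<in> {0..t}" "\<And>s. s \<in> {0..t} \<Longrightarrow> Y s2 \<omega> \<le> Y s \<omega>"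
    using continuous_attains_inf[OF _ _ ct] t by auto
  show thesis
  proof (rule that[of "- Y s2 \<omega>" "Y s1 \<omega>"])
    show "0 \<le> - Y s2 \<omega>" "0 \<le> Y s1 \<omega>" using s1(2)[of 0] s2(2)[of 0] t Y0 by auto
    show "\<forall>s\<in>{0..t}. - (- Y s2 \<omega>) \<le> Y s \<omega> \<and> Y s \<omega> \<le> Y s1 \<omega>" using s1 s2 by auto
    \<comment> \<open>By the intermediate value theorem \<open>Y\<close> takes every value
      \<open>v\<close> between 0 and its maximum, and the iterated path is then at
      \<open>z + Xp v \<omega>\<close>.\<close>
    show "\<forall>v\<in>{0..Y s1 \<omega>}. z + Xp v \<omega> \<in> D"
    proof
      fix v assume v: "v \<in> {0..Y s1 \<omega>}"
      have "\<exists>s\<ge>0. s \<le> s1 \<and> Y s \<omega> = v"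
        using v Y0 s1(1) ct by (intro IVT') (auto intro: continuous_on_subset)
      then obtain s where s: "0 \<le> s" "s \<le> s1" "Y s \<omega> = v" by blast
      then show "z + Xp v \<omega> \<in> D"
        using inD[of s] s1(1) v by (simp add: iterated_process_def two_sided_def)
    qed
    show "\<forall>v\<in>{0..- Y s2 \<omega>}. z + Xm v \<omega> \<in> D"
    proof
      fix v assume v: "v \<in> {0..- Y s2 \<omega>}"
      have "\<exists>s\<ge>0. s \<le> s2 \<and> Y s \<omega> = - v"
        using v Y0 s2(1) ct by (intro IVT2') (auto intro: continuous_on_subset)
      then obtain s where s: "0 \<le> s" "s \<le> s2" "Y s \<omega> = - v" by blast
      \<comment> \<open>At \<open>v = 0\<close> the two-sided path reads \<open>Xp\<close>; both
        paths start at 0.\<close>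
      then show "z + Xm v \<omega> \<in> D"
        using inD[of s] s2(1) v X0 by (cases "v = 0") (auto simp: iterated_process_def two_sided_def)
    qed
  qed
qed

lemma indep_processes3_prob:
  assumes "prob_space M" "indep_processes3 M X1 X2 X3"
    and "A \<in> process_events M X1" "B \<in> process_events M X2" "C \<in> process_events M X3"
  shows "measure M (A \<inter> B \<inter> C) = measure M A * measure M B * measure M C"
proof -
  interpret prob_space M by fact
  have three: "{..<3::nat} = {0, 1, 2}" by auto
  have "prob (\<Inter>j\<in>{..<3}. [A, B, C] ! j) = (\<Prod>j\<in>{..<3}. prob ([A, B, C] ! j))"
    using assms unfolding indep_processes3_def
    by (intro indep_setsD) (auto simp: three)
  then show ?thesis by (simp add: three Int_assoc mult.assoc)
qed

text \<open>The minimum over \<open>l\<close> of \<open>A l + B / l\<^sup>2\<close> is attained at \<open>l = (2 B / A) powr (1/3)\<close>.\<close>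

lemma linear_plus_inverse_square_ge:
  fixes A B l :: real
  assumes A: "A > 0" and B: "B > 0" and l: "l > 0"
  shows "A * l + B / l\<^sup>2 \<ge> 3 / 2 * A * (2 * B / A) powr (1 / 3)"
proof -
  define m where "m = (2 * B / A) powr (1 / 3)"
  have m: "m > 0" using A B by (simp add: m_def)
  have "m ^ 3 = m powr real 3" using m by (subst powr_realpow) auto
  then have "m ^ 3 = 2 * B / A" using A B by (simp add: m_def powr_powr)
  then have B_eq: "B = A * m ^ 3 / 2" using A by (simp add: field_simps)
  \<comment> \<open>The minimiser \<open>m\<close> is a double root of
    \<open>2 * l ^ 3 - 3 * m * l\<^sup>2 + m ^ 3\<close>.\<close>
  have "A * l + B / l\<^sup>2 - 3 / 2 * A * m = A / (2 * l\<^sup>2) * ((l - m)\<^sup>2 * (2 * l + m))"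
    unfolding B_eq using l by (simp add: field_simps power2_eq_square power3_eq_cube)
  also have "\<dots> \<ge> 0" using A l m by simp
  finally show ?thesis by (simp add: m_def)
qed

text \<open>\<open>A\<close> is the confinement cost per unit of scaled length and \<open>B\<close>
  the cost of a range of unit length. Logarithms make the identity linear in \<open>ln 2\<close>,
  \<open>ln 3\<close>, \<open>ln pi\<close> and \<open>ln j\<close>.\<close>

lemma C_const_eq:
  assumes p: "p > 0" and j: "j = bessel_zero ((real n - 2) / 2)" "j > 0"
  defines "A \<equiv> j\<^sup>2 / 2 * 3 powr (2 / p)" and "B \<equiv> pi\<^sup>2 / 2"
  shows "C_const n p = 3 / 2 * A * (2 * B / A) powr (1 / 3)"
proof -
  have lnA: "ln A = 2 * ln j - ln 2 + 2 / p * ln 3"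
    using j unfolding A_def by (simp add: ln_mult ln_div ln_powr ln_realpow)
  have A: "A > 0" using j by (simp add: A_def)
  have C: "C_const n p > 0" unfolding C_const_def j(1)[symmetric] using j(2) by simp
  have l8: "ln (8 :: real) = 3 * ln 2" using ln_realpow[of 2 3] by simp
  have "ln (C_const n p) = (4 + 3 * p) / (3 * p) * (ln 3 - ln 2) + 1 / 3 * ln 2
      + 2 / 3 * (2 * ln j + 2 / p * ln 2) + 1 / 3 * (2 * ln pi - 3 * ln 2)"
    unfolding C_const_def j(1)[symmetric] using j(2)
    by (simp add: ln_mult ln_div ln_powr ln_realpow l8)
  also have "\<dots> = ln 3 - ln 2 + ln A + 1 / 3 * (2 * ln pi - ln A)"
    unfolding lnA using p by (simp add: field_simps)
  also have "\<dots> = ln (3 / 2 * A * (2 * B / A) powr (1 / 3))"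
    using A by (simp add: B_def ln_mult ln_div ln_powr ln_realpow)
  finally show ?thesis using C A by (subst (asm) ln_inj_iff) (auto simp: B_def)
qed

text \<open>The range \<open>[-a, b]\<close> of \<open>Y\<close> on \<open>[0, t]\<close> is located on a grid of mesh \<open>\<eta> * space_scale p t\<close>; each cell
  contributes three independent events.\<close>

lemma iterated_survival_bound:
  fixes Xp Xm :: "real \<Rightarrow> 'w \<Rightarrow> (real ^ 'n) \<times> real" and Y :: "real \<Rightarrow> 'w \<Rightarrow> real"
  assumes Xp: "brownian_motion M Xp" and Xm: "brownian_motion M Xm" and Y: "brownian_motion M Y"
    and indep: "indep_processes3 M Xp Xm Y" and p: "p > 0" and V: "V < C_const CARD('n) p"
  obtains K where "K > 0"
    "eventually (\<lambda>t. measure M {\<omega> \<in> space M.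
        ereal t < exit_time (above_graph (\<lambda>x. exp (norm x powr p))) (iterated_process z Xp Xm Y) \<omega>}
      \<le> K * exp (- V * decay_rate p t)) at_top"
proof -
  interpret prob_space M by (rule brownian_prob_space[OF Xp])
  define D :: "((real ^ 'n) \<times> real) set" where "D = above_graph (\<lambda>x. exp (norm x powr p))"
  define j where "j = bessel_zero ((real CARD('n) - 2) / 2)"
  have "j = bessel_zero (real CARD('n) / 2 - 1)" by (simp add: j_def diff_divide_distrib)
  then have j: "j > 0" using bessel_zero_first(1)[of "real CARD('n) / 2"] by simp
  define A0 where "A0 = j\<^sup>2 / 2 * 3 powr (2 / p)"
  define B0 where "B0 = pi\<^sup>2 / 2"
  define V0 where "V0 = C_const CARD('n) p"
  have A0: "A0 > 0" using j by (simp add: A0_def)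
  have B0: "B0 > 0" by (simp add: B0_def)
  have V0_eq: "V0 = 3 / 2 * A0 * (2 * B0 / A0) powr (1 / 3)"
    unfolding V0_def A0_def B0_def by (rule C_const_eq[OF p j_def j])
  have V0: "V0 > 0" unfolding V0_eq using A0 B0 by simp
  define e where "e = V0 - V"
  have e: "e > 0" using V by (simp add: e_def V0_def)
  \<comment> \<open>The loss \<open>e\<close> is split in two: taking \<theta> below 1 puts the
    rates strictly below the eigenvalues and costs at most \<open>e / 2\<close>; the mesh \<eta>
    costs at most the other half.\<close>
  define \<theta> where "\<theta> = max (1 / 2) (1 - e / (2 * V0))"
  have \<theta>: "0 < \<theta>" "\<theta> < 1" "\<theta> * V0 \<ge> V0 - e / 2"
  proof -
    show "0 < \<theta>" "\<theta> < 1" using e V0 by (auto simp: \<theta>_def)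
    have "(1 - e / (2 * V0)) * V0 \<le> \<theta> * V0" using V0 by (intro mult_right_mono) (auto simp: \<theta>_def)
    then show "\<theta> * V0 \<ge> V0 - e / 2" using V0 by (simp add: left_diff_distrib)
  qed
  define \<eta> where "\<eta> = e / (4 * A0)"
  have \<eta>: "\<eta> > 0" "2 * A0 * \<eta> = e / 2" using e A0 by (auto simp: \<eta>_def)
  \<comment> \<open>Beyond \<open>m\<close> mesh lengths the confinement of a single path already
    costs at least \<open>V0\<close>, so finitely many cells remain.\<close>
  obtain m :: nat where "real m \<ge> V0 / (A0 * \<eta>)" using real_arch_simple by blast
  then have m: "V0 \<le> A0 * (real m * \<eta>)" using A0 \<eta> by (simp add: field_simps)
  define W where "W t = space_scale p t" for t
  define \<psi> where "\<psi> t = decay_rate p t" for t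

  have "j\<^sup>2 > 0" using j by simp
  then have \<theta>j: "0 \<le> \<theta> * (j\<^sup>2 / 2)" "\<theta> * (j\<^sup>2 / 2) < j\<^sup>2 / 2" using \<theta> by auto
  have \<theta>pi: "0 \<le> \<theta> * B0" "\<theta> * B0 < pi\<^sup>2 / 2" using \<theta> B0 by (auto simp: B0_def)
  have domain: "eventually (\<lambda>t. \<exists>A\<in>process_events M X.
      (\<forall>\<omega>\<in>space M. (\<forall>v\<in>{0..real i * \<eta> * W t}. z + X v \<omega> \<in> D) \<longrightarrow> \<omega> \<in> A) \<and>
      measure M A \<le> exp (- (\<theta> * A0 * (real i * \<eta>)) * \<psi> t)) at_top"
    if X: "brownian_motion M X" for X :: "real \<Rightarrow> 'w \<Rightarrow> (real ^ 'n) \<times> real" and i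
  \<comment> \<open>The scaled estimate asks for a positive duration; duration 0 is served by the
    whole space with bound 1.\<close>
  proof (cases "i = 0")
    case True
    have "{\<omega> \<in> space M. True} \<in> process_events M X" 
      by (rule process_eventsI) (rule sets.sets_Collect_const)
    then show ?thesis using True prob_space by (intro always_eventually allI bexI[of _ "space M"]) auto
  next
    case False
    then have "real i * \<eta> > 0" using \<eta> by simp
    from brownian_domain_survival_scaled[OF X p \<theta>j[unfolded j_def] this]
    show ?thesis unfolding D_def W_def \<psi>_def A0_def j_def by (simp add: mult.assoc)
  qed
  have range: "eventually (\<lambda>t. \<exists>A\<in>process_events M Y.
      (\<forall>\<omega>\<in>space M. (\<forall>v\<in>{0..t}. - (real (Suc i) * \<eta> * W t) \<le> Y v \<omega> \<and> Y v \<omega> \<le> real (Suc k) * \<eta> * W t) \<longrightarrow> \<omega> \<in> A) \<and>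
      measure M A \<le> exp (- (\<theta> * B0 / (real (Suc i) * \<eta> + real (Suc k) * \<eta>)\<^sup>2) * \<psi> t)) at_top" for i k
  proof -
    have "real (Suc i) * \<eta> + real (Suc k) * \<eta> > 0" using \<eta> by (intro add_pos_pos) auto
    from brownian_interval_survival_scaled[OF Y \<theta>pi p this] show ?thesis unfolding W_def \<psi>_def .
  qed
  \<comment> \<open>In a cell the two paths survive up to the lower ends, while \<open>Y\<close> is
    confined by the upper ends. The two lengths differ by \<open>2 * \<eta>\<close>, whence the loss
    \<open>2 * A0 * \<eta>\<close>.\<close>
  have cell: "\<theta> * A0 * (real k * \<eta>) + \<theta> * A0 * (real i * \<eta>) + \<theta> * B0 / (real (Suc i) * \<eta> + real (Suc k) * \<eta>)\<^sup>2 \<ge> V" for i k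
  proof -
    define l where "l = real (Suc i) * \<eta> + real (Suc k) * \<eta>"
    have l: "l > 0" unfolding l_def using \<eta> by (intro add_pos_pos) auto
    have "\<theta> * V0 \<le> \<theta> * (A0 * l + B0 / l\<^sup>2)"
      unfolding V0_eq using \<theta> by (intro mult_left_mono linear_plus_inverse_square_ge A0 B0 l) auto
    also have "\<dots> = \<theta> * A0 * (real k * \<eta>) + \<theta> * A0 * (real i * \<eta>) + \<theta> * B0 / l\<^sup>2 + \<theta> * (2 * A0 * \<eta>)"
      unfolding l_def by (simp add: algebra_simps)
    finally have "\<theta> * V0 \<le> \<dots>" .
    moreover have "\<theta> * (2 * A0 * \<eta>) \<le> 1 * (e / 2)" unfolding \<eta>(2) using \<theta> e by (intro mult_right_mono) auto
    ultimately show ?thesis using \<theta>(3) unfolding l_def[symmetric] e_def by argo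
  qed
  have tail: "\<theta> * A0 * (real m * \<eta>) \<ge> V"
  proof -
    have "\<theta> * V0 \<le> \<theta> * (A0 * (real m * \<eta>))" using m \<theta> by (intro mult_left_mono) auto
    then show ?thesis using \<theta>(3) e unfolding e_def mult.assoc by argo
  qed

  have ev: "eventually (\<lambda>t. (\<forall>i\<in>{..m}. \<exists>A\<in>process_events M Xp.
      (\<forall>\<omega>\<in>space M. (\<forall>v\<in>{0..real i * \<eta> * W t}. z + Xp v \<omega> \<in> D) \<longrightarrow> \<omega> \<in> A) \<and>
      measure M A \<le> exp (- (\<theta> * A0 * (real i * \<eta>)) * \<psi> t)) \<and>
     (\<forall>i\<in>{..m}. \<exists>A\<in>process_events M Xm.
      (\<forall>\<omega>\<in>space M. (\<forall>v\<in>{0..real i * \<eta> * W t}. z + Xm v \<omega> \<in> D) \<longrightarrow> \<omega> \<in> A) \<and>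
      measure M A \<le> exp (- (\<theta> * A0 * (real i * \<eta>)) * \<psi> t)) \<and>
     (\<forall>i\<in>{..<m}. \<forall>k\<in>{..<m}. \<exists>A\<in>process_events M Y.
      (\<forall>\<omega>\<in>space M. (\<forall>v\<in>{0..t}. - (real (Suc i) * \<eta> * W t) \<le> Y v \<omega> \<and> Y v \<omega> \<le> real (Suc k) * \<eta> * W t) \<longrightarrow> \<omega> \<in> A) \<and>
      measure M A \<le> exp (- (\<theta> * B0 / (real (Suc i) * \<eta> + real (Suc k) * \<eta>)\<^sup>2) * \<psi> t))) at_top"
    by (intro eventually_conj eventually_ball_finite ballI domain[OF Xp] domain[OF Xm] range finite_atMost finite_lessThan)
  show thesis
  proof (rule that[of "real m * real m + 2"])
    show "real m * real m + 2 > 0" by (simp add: add_nonneg_pos)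
    from ev eventually_gt_at_top[of 1]
    show "eventually (\<lambda>t. measure M {\<omega> \<in> space M.
        ereal t < exit_time (above_graph (\<lambda>x. exp (norm x powr p))) (iterated_process z Xp Xm Y) \<omega>}
      \<le> (real m * real m + 2) * exp (- V * decay_rate p t)) at_top"
    proof eventually_elim
      case (elim t)
      have \<psi>: "\<psi> t > 0" and W: "W t > 0" using scale_relations[OF elim(2) p] by (auto simp: \<psi>_def W_def)
      obtain P where P0: "\<forall>i\<in>{..m}. P i \<in> process_events M Xp \<and>
        (\<forall>\<omega>\<in>space M. (\<forall>v\<in>{0..real i * \<eta> * W t}. z + Xp v \<omega> \<in> D) \<longrightarrow> \<omega> \<in> P i) \<and>
        prob (P i) \<le> exp (- (\<theta> * A0 * (real i * \<eta>)) * \<psi> t)"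
        using bchoice[OF elim(1)[THEN conjunct1, unfolded Bex_def]] by blast
      have P: "\<And>i. i \<le> m \<Longrightarrow> P i \<in> process_events M Xp"
        "\<And>i \<omega>. i \<le> m \<Longrightarrow> \<omega> \<in> space M \<Longrightarrow> (\<forall>v\<in>{0..real i * \<eta> * W t}. z + Xp v \<omega> \<in> D) \<Longrightarrow> \<omega> \<in> P i"
        "\<And>i. i \<le> m \<Longrightarrow> prob (P i) \<le> exp (- (\<theta> * A0 * (real i * \<eta>)) * \<psi> t)"
        using P0 by (auto simp only: atMost_iff)
      obtain Q where Q0: "\<forall>i\<in>{..m}. Q i \<in> process_events M Xm \<and>
        (\<forall>\<omega>\<in>space M. (\<forall>v\<in>{0..real i * \<eta> * W t}. z + Xm v \<omega> \<in> D) \<longrightarrow> \<omega> \<in> Q i) \<and>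
        prob (Q i) \<le> exp (- (\<theta> * A0 * (real i * \<eta>)) * \<psi> t)"
        using bchoice[OF elim(1)[THEN conjunct2, THEN conjunct1, unfolded Bex_def]] by blast
      have Q: "\<And>i. i \<le> m \<Longrightarrow> Q i \<in> process_events M Xm"
        "\<And>i \<omega>. i \<le> m \<Longrightarrow> \<omega> \<in> space M \<Longrightarrow> (\<forall>v\<in>{0..real i * \<eta> * W t}. z + Xm v \<omega> \<in> D) \<Longrightarrow> \<omega> \<in> Q i"
        "\<And>i. i \<le> m \<Longrightarrow> prob (Q i) \<le> exp (- (\<theta> * A0 * (real i * \<eta>)) * \<psi> t)"
        using Q0 by (auto simp only: atMost_iff)
      have "\<forall>ik\<in>{..<m} \<times> {..<m}. \<exists>A. A \<in> process_events M Y \<and>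
        (\<forall>\<omega>\<in>space M. (\<forall>v\<in>{0..t}. - (real (Suc (fst ik)) * \<eta> * W t) \<le> Y v \<omega> \<and> Y v \<omega> \<le> real (Suc (snd ik)) * \<eta> * W t) \<longrightarrow> \<omega> \<in> A) \<and>
        prob A \<le> exp (- (\<theta> * B0 / (real (Suc (fst ik)) * \<eta> + real (Suc (snd ik)) * \<eta>)\<^sup>2) * \<psi> t)"
        (is "\<forall>ik\<in>_. ?A ik")
      proof
        fix ik assume "ik \<in> {..<m} \<times> {..<m}"
        then have "fst ik \<in> {..<m}" "snd ik \<in> {..<m}" by auto
        from bspec[OF bspec[OF elim(1)[THEN conjunct2, THEN conjunct2] this(1)] this(2)]
        show "?A ik" unfolding Bex_def .
      qed
      from bchoice[OF this] obtain R' where R': "\<forall>ik\<in>{..<m} \<times> {..<m}. R' ik \<in> process_events M Y \<and>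
        (\<forall>\<omega>\<in>space M. (\<forall>v\<in>{0..t}. - (real (Suc (fst ik)) * \<eta> * W t) \<le> Y v \<omega> \<and> Y v \<omega> \<le> real (Suc (snd ik)) * \<eta> * W t) \<longrightarrow> \<omega> \<in> R' ik) \<and>
        prob (R' ik) \<le> exp (- (\<theta> * B0 / (real (Suc (fst ik)) * \<eta> + real (Suc (snd ik)) * \<eta>)\<^sup>2) * \<psi> t)"
        by blast
      have R: "R' (i, k) \<in> process_events M Y"
        "prob (R' (i, k)) \<le> exp (- (\<theta> * B0 / (real (Suc i) * \<eta> + real (Suc k) * \<eta>)\<^sup>2) * \<psi> t)"
        "\<omega> \<in> space M \<Longrightarrow> (\<And>v. v\<in>{0..t} \<Longrightarrow> - (real (Suc i) * \<eta> * W t) \<le> Y v \<omega> \<and> Y v \<omega> \<le> real (Suc k) * \<eta> * W t) \<Longrightarrow> \<omega> \<in> R' (i, k)"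
        if "i < m" "k < m" for i k \<omega>
        using bspec[OF R', of "(i, k)"] that by (auto simp del: of_nat_Suc)
      have Pm: "P i \<in> events" and Qm: "Q i \<in> events" if "i \<le> m" for i
        using P(1)[OF that] Q(1)[OF that] process_events_subset brownian_measurable[OF Xp] brownian_measurable[OF Xm]
        by blast+
      have Rm: "R' (i, k) \<in> events" if "i < m" "k < m" for i k
        using R(1)[OF that] process_events_subset brownian_measurable[OF Y] by blast
      \<comment> \<open>The first index counts the negative part of the range, followed by
        \<open>Xm\<close>, the second the positive part, followed by \<open>Xp\<close>.\<close>
      define cells where "cells = (\<Union>ik\<in>{..<m} \<times> {..<m}. P (snd ik) \<inter> Q (fst ik) \<inter> R' ik)"
      have cells_m: "cells \<in> events" unfolding cells_def using Pm Qm Rm by (intro sets.finite_UN sets.Int) auto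
      define E where "E = {\<omega> \<in> space M. ereal t < exit_time D (iterated_process z Xp Xm Y) \<omega>}"
      have "E \<subseteq> cells \<union> P m \<union> Q m"
      proof
        fix \<omega> assume "\<omega> \<in> E"
        then have \<omega>: "\<omega> \<in> space M" and exit: "ereal t < exit_time D (iterated_process z Xp Xm Y) \<omega>"
          by (auto simp: E_def)
        obtain a b where ab: "a \<ge> 0" "b \<ge> 0" "\<forall>s\<in>{0..t}. - a \<le> Y s \<omega> \<and> Y s \<omega> \<le> b"
          "\<forall>v\<in>{0..b}. z + Xp v \<omega> \<in> D" "\<forall>v\<in>{0..a}. z + Xm v \<omega> \<in> D"
        proof (rule iterated_survival_range[OF _ exit])
          show "0 \<le> t" using elim(2) by simp
        qed (use brownian_continuous[OF Y \<omega>] brownian_0[OF Y \<omega>] brownian_0[OF Xp \<omega>] brownian_0[OF Xm \<omega>] in auto)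
        define h where "h = \<eta> * W t"
        have h: "h > 0" using \<eta> W by (simp add: h_def)
        define i where "i = nat \<lfloor>a / h\<rfloor>"
        define k where "k = nat \<lfloor>b / h\<rfloor>"
        have bounds: "real (nat \<lfloor>c / h\<rfloor>) * h \<le> c" "c \<le> real (Suc (nat \<lfloor>c / h\<rfloor>)) * h" if "c \<ge> 0" for c
        proof -
          have "real (nat \<lfloor>c / h\<rfloor>) \<le> c / h" "c / h \<le> real (Suc (nat \<lfloor>c / h\<rfloor>))"
            using that h real_of_int_floor_add_one_ge[of "c / h"] by (auto simp: add.commute)
          then show "real (nat \<lfloor>c / h\<rfloor>) * h \<le> c" "c \<le> real (Suc (nat \<lfloor>c / h\<rfloor>)) * h"
            using h by (simp_all add: pos_le_divide_eq pos_divide_le_eq del: of_nat_Suc)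
        qed
        have ib: "real i * h \<le> a" "a \<le> real (Suc i) * h" and kb: "real k * h \<le> b" "b \<le> real (Suc k) * h"
          unfolding i_def k_def using bounds ab(1,2) by blast+
        have inP: "\<omega> \<in> P l" if "l \<le> m" "l \<le> k" for l
        proof (rule P(2)[OF that(1) \<omega>])
          have "real l * h \<le> real k * h" using that h by simp
          then show "\<forall>v\<in>{0..real l * \<eta> * W t}. z + Xp v \<omega> \<in> D"
            using ab(4) kb(1) by (auto simp: h_def mult.assoc)
        qed
        have inQ: "\<omega> \<in> Q l" if "l \<le> m" "l \<le> i" for l
        proof (rule Q(2)[OF that(1) \<omega>])
          have "real l * h \<le> real i * h" using that h by simp
          then show "\<forall>v\<in>{0..real l * \<eta> * W t}. z + Xm v \<omega> \<in> D"
            using ab(5) ib(1) by (auto simp: h_def mult.assoc)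
        qed
        show "\<omega> \<in> cells \<union> P m \<union> Q m"
        proof (cases "i < m \<and> k < m")
          case True
          then have "\<omega> \<in> R' (i, k)"
          proof (intro R(3) \<omega>)
            fix v assume "v \<in> {0..t}"
            then have "- a \<le> Y v \<omega> \<and> Y v \<omega> \<le> b" using ab(3) by blast
            then show "- (real (Suc i) * \<eta> * W t) \<le> Y v \<omega> \<and> Y v \<omega> \<le> real (Suc k) * \<eta> * W t"
              using ib(2) kb(2) unfolding h_def mult.assoc by linarith
          qed auto
          then have "\<omega> \<in> P (snd (i, k)) \<inter> Q (fst (i, k)) \<inter> R' (i, k)" using inP[of k] inQ[of i] True by auto
          then show ?thesis unfolding cells_def using True by blast
        next
          case False
          \<comment> \<open>\<open>i \<ge> m\<close> gives membership in \<open>Q m\<close>, and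
            \<open>k \<ge> m\<close> membership in \<open>P m\<close>.\<close>
          then show ?thesis using inP[of m] inQ[of m] by auto
        qed
      qed
      then have "prob E \<le> prob (cells \<union> P m \<union> Q m)"
        using cells_m Pm Qm by (intro finite_measure_mono) auto
      also have "\<dots> \<le> prob cells + prob (P m) + prob (Q m)"
        using cells_m Pm[of m] Qm[of m] measure_subadditive[of "cells \<union> P m" M "Q m"] measure_subadditive[of cells M "P m"]
        by (fastforce simp: emeasure_eq_measure)
      also have "prob cells \<le> (\<Sum>ik\<in>{..<m} \<times> {..<m}. prob (P (snd ik) \<inter> Q (fst ik) \<inter> R' ik))"
        unfolding cells_def using Pm Qm Rm by (intro finite_measure_subadditive_finite) auto
      also have "\<dots> \<le> (\<Sum>ik\<in>{..<m} \<times> {..<m}. exp (- V * \<psi> t))"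
      proof (rule sum_mono)
        fix ik assume "ik \<in> {..<m} \<times> {..<m}"
        then obtain i k where ik_eq: "ik = (i, k)" and ik: "i \<in> {..<m}" "k \<in> {..<m}" by auto
        then have "prob (P k \<inter> Q i \<inter> R' (i, k)) = prob (P k) * prob (Q i) * prob (R' (i, k))"
          by (intro indep_processes3_prob[OF prob_space_axioms indep] P(1) Q(1) R(1)) auto
        also have "\<dots> \<le> exp (- (\<theta> * A0 * (real k * \<eta>)) * \<psi> t) * exp (- (\<theta> * A0 * (real i * \<eta>)) * \<psi> t)
            * exp (- (\<theta> * B0 / (real (Suc i) * \<eta> + real (Suc k) * \<eta>)\<^sup>2) * \<psi> t)"
          using ik by (intro mult_mono P(3) Q(3) R(2)) auto
        also have "\<dots> = exp (- (\<theta> * A0 * (real k * \<eta>) + \<theta> * A0 * (real i * \<eta>)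
            + \<theta> * B0 / (real (Suc i) * \<eta> + real (Suc k) * \<eta>)\<^sup>2) * \<psi> t)"
          by (simp only: exp_add[symmetric] distrib_right minus_add_distrib mult_minus_left)
        also have "\<dots> \<le> exp (- V * \<psi> t)" 
          unfolding exp_le_cancel_iff mult_minus_left neg_le_iff_le
          using \<psi> by (intro mult_right_mono cell) auto
        finally show "prob (P (snd ik) \<inter> Q (fst ik) \<inter> R' ik) \<le> exp (- V * \<psi> t)" by (simp add: ik_eq)
      qed
      also have "\<dots> = real m * real m * exp (- V * \<psi> t)" by simp
      also have "prob (P m) \<le> exp (- V * \<psi> t)"
        using P(3)[of m] mult_right_mono[OF tail, of "\<psi> t"] \<psi>
        by (intro order_trans[OF P(3)[OF order_refl]]) simp
      also have "prob (Q m) \<le> exp (- V * \<psi> t)"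
        using Q(3)[of m] mult_right_mono[OF tail, of "\<psi> t"] \<psi>
        by (intro order_trans[OF Q(3)[OF order_refl]]) simp
      finally show ?case unfolding E_def D_def \<psi>_def by (simp add: algebra_simps)
    qed
  qed
qed

section \<open>Passage to the limit superior\<close>

theorem corollary1p2:
  fixes M :: "'w measure"
    and Xp Xm :: "real \<Rightarrow> 'w \<Rightarrow> (real ^ 'n) \<times> real"
    and Y :: "real \<Rightarrow> 'w \<Rightarrow> real"
    and p :: real
    and f :: "real ^ 'n \<Rightarrow> real"
    and z :: "(real ^ 'n) \<times> real"
  assumes "brownian_motion M Xp"
    and "brownian_motion M Xm"
    and "brownian_motion M Y"
    and "indep_processes3 M Xp Xm Y"
    and "p > 0"
    and "\<And>x. f x = exp (norm x powr p)"
    and "z \<in> above_graph f"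
  shows "Limsup at_top (\<lambda>t::real. ereal (t powr (- 1 / 3) * (ln t) powr (4 / (3 * p))) *
           eln (measure M {\<omega> \<in> space M.
             ereal t < exit_time (above_graph f) (iterated_process z Xp Xm Y) \<omega>}))
         \<le> ereal (- C_const CARD('n) p)"
proof (rule ereal_le_epsilon2)
  fix e :: real assume e: "0 < e"
  define V where "V = C_const CARD('n) p - e"
  have f: "f = (\<lambda>x. exp (norm x powr p))" using assms(6) by blast
  define \<mu> where "\<mu> t = measure M {\<omega> \<in> space M. ereal t < exit_time (above_graph f) (iterated_process z Xp Xm Y) \<omega>}" for t
  have "V < C_const CARD('n) p" using e by (simp add: V_def)
  from iterated_survival_bound[OF assms(1-5) this, of z] obtain K where K: "K > 0"
    "eventually (\<lambda>t. \<mu> t \<le> K * exp (- V * decay_rate p t)) at_top"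
    unfolding \<mu>_def f by blast
  have "eventually (\<lambda>t. ereal (t powr (- 1 / 3) * (ln t) powr (4 / (3 * p))) * eln (\<mu> t)
      \<le> ereal (ln K / decay_rate p t - V)) at_top"
    using K(2) eventually_gt_at_top[of 1]
  proof eventually_elim
    case (elim t)
    note sc = scale_relations[OF elim(2) assms(5)]
    show ?case
    proof (cases "\<mu> t \<le> 0")
      case True
      \<comment> \<open>Vanishing probability: \<open>eln\<close> is -\<infinity>, and
        multiplication by the positive normalising factor leaves it so.\<close>
      then show ?thesis unfolding sc(5) using sc(1) by (simp add: eln_def)
    next
      case False
      have "ln (\<mu> t) \<le> ln (K * exp (- V * decay_rate p t))" using False elim(1) by (intro ln_mono) auto
      also have "\<dots> = ln K - V * decay_rate p t" using K(1) by (simp add: ln_mult)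
      finally have "1 / decay_rate p t * ln (\<mu> t) \<le> 1 / decay_rate p t * (ln K - V * decay_rate p t)"
        using sc(1) by (intro mult_left_mono) auto
      also have "\<dots> = ln K / decay_rate p t - V" using sc(1) by (simp add: field_simps)
      finally show ?thesis unfolding sc(5) using False by (simp add: eln_def)
    qed
  qed
  then have "Limsup at_top (\<lambda>t. ereal (t powr (- 1 / 3) * (ln t) powr (4 / (3 * p))) * eln (\<mu> t))
      \<le> Limsup at_top (\<lambda>t. ereal (ln K / decay_rate p t - V))"
    by (rule Limsup_mono)
  also have "\<dots> = ereal (0 - V)"
  proof (rule lim_imp_Limsup)
    \<comment> \<open>The constant \<open>K\<close> disappears because \<open>decay_rate\<close>
      diverges.\<close>
    have "((\<lambda>t. ln K / decay_rate p t) \<longlongrightarrow> 0) at_top"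
      by (intro tendsto_divide_0[OF tendsto_const] filterlim_at_top_imp_at_infinity decay_rate_at_top assms)
    then show "((\<lambda>t. ereal (ln K / decay_rate p t - V)) \<longlongrightarrow> ereal (0 - V)) at_top"
      by (intro tendsto_ereal tendsto_diff tendsto_const)
  qed simp
  finally show "Limsup at_top (\<lambda>t::real. ereal (t powr (- 1 / 3) * (ln t) powr (4 / (3 * p))) *
           eln (measure M {\<omega> \<in> space M.
             ereal t < exit_time (above_graph f) (iterated_process z Xp Xm Y) \<omega>}))
         \<le> ereal (- C_const CARD('n) p) + ereal e"
    unfolding \<mu>_def by (simp add: V_def)
qed

end
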